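(* Let $x\in B_3$. Then: (i) $\sup_{\sf d}(x)=M(\rho_3(x))$; (ii) $\inf_{\sf d}(x)=m(\rho_3(x))$; (iii) one can compute the dual normal form of $x$ from the matrix $\rho_3(x)$ (that is, there is an algorithm which, given the matrix $\rho_3(x)$ of a braid $x\in B_3$, outputs $N_{\sf d}(x)$).
   Context: $B_3$ is the 3-strand braid group with Artin generators $\sigma_1,\sigma_2$. The reduced Burau representation $\rho_3:B_3\to GL(2,\mathbb Z[q^{\pm1}])$ is the homomorphism ($\rho_3(xy)=\rho_3(x)\rho_3(y)$) with $\rho_3(\sigma_1)=\begin{pmatrix}-q&0\\1&1\end{pmatrix}$, $\rho_3(\sigma_2)=\begin{pmatrix}1&q\\0&-q\end{pmatrix}$. For a non-zero Laurent polynomial $\Lambda$ in $q$, $m(\Lambda)$ and $M(\Lambda)$ are the minimal and maximal degrees of $q$ in $\Lambda$; $m(0)=+\infty$, $M(0)=-\infty$. For a matrix $\Lambda=(\Lambda_{ij})$, $m(\Lambda)=\min_{i,j}m(\Lambda_{ij})$ and $M(\Lambda)=\max_{i,j}M(\Lambda_{ij})$. Dual Garside structure: $a_{1,2}=\sigma_1$, $a_{2,3}=\sigma_2$, $a_{1,3}=\sigma_1^{-1}\sigma_2\sigma_1$, $\delta=\sigma_2\sigma_1$. $B_3^{+*}$ is the monoid generated by the $a_{i,j}$, and $x\preccurlyeq_{\sf d}y$ iff $x^{-1}y\in B_3^{+*}$ (a lattice order). Dual simple elements are the $d$ with $1\preccurlyeq_{\sf d}d\preccurlyeq_{\sf d}\delta$.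 A pair $(d,d')$ of dual simple elements is left-weighted if $\delta\wedge_{\sf d}(dd')=d$, with $\wedge_{\sf d}$ the meet for $\preccurlyeq_{\sf d}$. Every $x\in B_3$ has a unique dual (left) normal form $N_{\sf d}(x)=\delta^pd_1\cdots d_r$ with $p\in\mathbb Z$, $d_i$ dual simple, $d_1\ne\delta$, $d_r\neq1$ and all $(d_i,d_{i+1})$ left-weighted; $\sup_{\sf d}(x)=p+r$ and $\inf_{\sf d}(x)=p$. *)

theory Defs
  imports
    "HOL-Analysis.Analysis"
    "HOL-Library.Poly_Mapping"
    "HOL-Library.Extended"
    "HOL-Library.Nat_Bijection"
begin

section \<open>The braid group on three strands\<close>

datatype artin = S1 | S2

datatype letter = Pos artin | Neg artin

inductive braid_eq :: "letter list \<Rightarrow> letter list \<Rightarrow> bool" where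
  refl: "braid_eq u u"
| sym: "braid_eq u v \<Longrightarrow> braid_eq v u"
| trans: "braid_eq u v \<Longrightarrow> braid_eq v w \<Longrightarrow> braid_eq u w"
| cancel_right: "braid_eq (u @ [Pos i, Neg i] @ v) (u @ v)"
| cancel_left: "braid_eq (u @ [Neg i, Pos i] @ v) (u @ v)"
| braid: "braid_eq (u @ [Pos S1, Pos S2, Pos S1] @ v) (u @ [Pos S2, Pos S1, Pos S2] @ v)"

lemma braid_eq_context: "braid_eq u v \<Longrightarrow> braid_eq (a @ u @ b) (a @ v @ b)"
proof (induction rule: braid_eq.induct)
  case (cancel_right u i v)
  show ?case using braid_eq.cancel_right[of "a @ u" i "v @ b"] by simp
next
  case (cancel_left u i v)
  show ?case using braid_eq.cancel_left[of "a @ u" i "v @ b"] by simp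
next
  case (braid u v)
  show ?case using braid_eq.braid[of "a @ u" "v @ b"] by simp
qed (auto intro: braid_eq.intros)

lemma braid_eq_append:
  assumes "braid_eq u u'" and "braid_eq v v'"
  shows "braid_eq (u @ v) (u' @ v')"
  using braid_eq_context[OF assms(1), of "[]" v] braid_eq_context[OF assms(2), of u' "[]"]
  by (auto intro: braid_eq.trans)

fun flip :: "letter \<Rightarrow> letter" where
  "flip (Pos i) = Neg i"
| "flip (Neg i) = Pos i"

definition word_inverse :: "letter list \<Rightarrow> letter list" where
  "word_inverse u = rev (map flip u)"

lemma word_inverse_simps:
  "word_inverse [] = []"
  "word_inverse (l # u) = word_inverse u @ [flip l]"
  "word_inverse (u @ v) = word_inverse v @ word_inverse u"
  by (simp_all add: word_inverse_def)

lemma braid_eq_cancel: "braid_eq (u @ [l, flip l] @ v) (u @ v)"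
  by (cases l) (use braid_eq.cancel_right braid_eq.cancel_left in \<open>auto\<close>)

lemma word_inverse_right: "braid_eq (u @ word_inverse u) []"
proof (induction u)
  case Nil
  show ?case by (simp add: word_inverse_simps braid_eq.refl)
next
  case (Cons l u)
  have "braid_eq ([l] @ (u @ word_inverse u) @ [flip l]) ([l] @ [] @ [flip l])"
    by (rule braid_eq_context[OF Cons.IH])
  moreover have "braid_eq [l, flip l] []"
    using braid_eq_cancel[of "[]" l "[]"] by simp
  ultimately show ?case
    by (auto simp: word_inverse_simps intro: braid_eq.trans)
qed

lemma word_inverse_left: "braid_eq (word_inverse u @ u) []"
proof -
  have "flip (flip l) = l" for l by (cases l) auto
  then have "word_inverse (word_inverse u) = u"
    by (simp add: word_inverse_def rev_map o_def)
  then show ?thesis using word_inverse_right[of "word_inverse u"] by simp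
qed

lemma braid_eq_word_inverse:
  assumes "braid_eq u v"
  shows "braid_eq (word_inverse u) (word_inverse v)"
proof -
  have "braid_eq (word_inverse u @ []) (word_inverse u @ (v @ word_inverse v))"
    by (intro braid_eq_append braid_eq.refl braid_eq.sym[OF word_inverse_right])
  moreover have "braid_eq (word_inverse u @ v @ word_inverse v) (word_inverse u @ u @ word_inverse v)"
    by (rule braid_eq_context[OF braid_eq.sym[OF assms]])
  moreover have "braid_eq ((word_inverse u @ u) @ word_inverse v) ([] @ word_inverse v)"
    by (intro braid_eq_append braid_eq.refl word_inverse_left)
  ultimately show ?thesis by (auto intro: braid_eq.trans)
qed

quotient_type braid3 = "letter list" / braid_eq
  by (auto intro!: equivpI reflpI sympI transpI intro: braid_eq.intros)

instantiation braid3 :: "{monoid_mult, inverse}"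
begin

lift_definition one_braid3 :: braid3 is "[]" .

lift_definition times_braid3 :: "braid3 \<Rightarrow> braid3 \<Rightarrow> braid3" is "(@)"
  by (rule braid_eq_append)

lift_definition inverse_braid3 :: "braid3 \<Rightarrow> braid3" is word_inverse
  by (rule braid_eq_word_inverse)

definition divide_braid3 :: "braid3 \<Rightarrow> braid3 \<Rightarrow> braid3" where
  "divide_braid3 x y = x * inverse y"

instance
  by standard (transfer, simp add: braid_eq.refl)+

end

lemma braid3_right_inverse: "x * inverse x = (1 :: braid3)"
  by transfer (rule word_inverse_right)

lemma braid3_left_inverse: "inverse x * x = (1 :: braid3)"
  by transfer (rule word_inverse_left)

lift_definition \<sigma>\<^sub>1 :: braid3 is "[Pos S1]" .
lift_definition \<sigma>\<^sub>2 :: braid3 is "[Pos S2]" .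

lemma braid3_relation: "\<sigma>\<^sub>1 * \<sigma>\<^sub>2 * \<sigma>\<^sub>1 = \<sigma>\<^sub>2 * \<sigma>\<^sub>1 * \<sigma>\<^sub>2"
  by transfer (use braid_eq.braid[of "[]" "[]"] in simp)


section \<open>The reduced Burau representation\<close>

text \<open>Laurent polynomials with integer coefficients form the group ring of the additive group
  of the integers: the coefficient of \<open>q\<close> to the power \<open>k\<close> is the value at \<open>k\<close>.\<close>

type_synonym laurent = "int \<Rightarrow>\<^sub>0 int"

definition q :: laurent where "q = Poly_Mapping.single 1 1"
definition q_inv :: laurent where "q_inv = Poly_Mapping.single (-1) 1"

lemma q_q_inv: "q * q_inv = 1" "q_inv * q = 1"
  by (simp_all add: q_def q_inv_def mult_single)

fun burau_letter :: "letter \<Rightarrow> laurent^2^2" where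
  "burau_letter (Pos S1) = vector [vector [- q, 0], vector [1, 1]]"
| "burau_letter (Pos S2) = vector [vector [1, q], vector [0, - q]]"
| "burau_letter (Neg S1) = vector [vector [- q_inv, 0], vector [q_inv, 1]]"
| "burau_letter (Neg S2) = vector [vector [1, 1], vector [0, - q_inv]]"

definition burau_word :: "letter list \<Rightarrow> laurent^2^2" where
  "burau_word u = foldr (\<lambda>l A. burau_letter l ** A) u (mat 1)"

lemma burau_word_simps:
  "burau_word [] = mat 1"
  "burau_word (l # u) = burau_letter l ** burau_word u"
  by (simp_all add: burau_word_def)

lemma burau_word_append: "burau_word (u @ v) = burau_word u ** burau_word v"
  by (induction u) (simp_all add: burau_word_simps matrix_mul_assoc)

lemma burau_word_cancel:
  "burau_word [Pos i, Neg i] = mat 1" "burau_word [Neg i, Pos i] = mat 1"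
  by (cases i; simp add: burau_word_simps vec_eq_iff forall_2 matrix_matrix_mult_def sum_2
        mat_def q_q_inv)+

lemma burau_word_braid:
  "burau_word [Pos S1, Pos S2, Pos S1] = burau_word [Pos S2, Pos S1, Pos S2]"
  by (simp add: burau_word_simps vec_eq_iff forall_2 matrix_matrix_mult_def sum_2 mat_def
        algebra_simps)

lift_definition \<rho>\<^sub>3 :: "braid3 \<Rightarrow> laurent^2^2" is burau_word
proof -
  show "burau_word u = burau_word v" if "braid_eq u v" for u v
    using that
  proof (induction rule: braid_eq.induct)
    case (cancel_right u i v)
    show ?case unfolding burau_word_append burau_word_cancel by simp
  next
    case (cancel_left u i v)
    show ?case unfolding burau_word_append burau_word_cancel by simp
  next
    case (braid u v)
    show ?case unfolding burau_word_append burau_word_braid by simp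
  qed auto
qed

lemma rho3_generators:
  "\<rho>\<^sub>3 \<sigma>\<^sub>1 = vector [vector [- q, 0], vector [1, 1]]"
  "\<rho>\<^sub>3 \<sigma>\<^sub>2 = vector [vector [1, q], vector [0, - q]]"
  by (simp_all add: \<sigma>\<^sub>1_def \<sigma>\<^sub>2_def \<rho>\<^sub>3.abs_eq burau_word_simps)

lemma rho3_one: "\<rho>\<^sub>3 1 = mat 1"
  by (simp add: one_braid3_def \<rho>\<^sub>3.abs_eq burau_word_simps)

lemma rho3_mult: "\<rho>\<^sub>3 (x * y) = \<rho>\<^sub>3 x ** \<rho>\<^sub>3 y"
  by transfer (rule burau_word_append)

lemma rho3_invertible: "invertible (\<rho>\<^sub>3 x)"
  unfolding invertible_def
  by (metis rho3_mult rho3_one braid3_left_inverse braid3_right_inverse)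

definition min_deg :: "laurent \<Rightarrow> int extended" where
  "min_deg \<Lambda> = (if \<Lambda> = 0 then Pinf else Fin (Min (Poly_Mapping.keys \<Lambda>)))"

definition max_deg :: "laurent \<Rightarrow> int extended" where
  "max_deg \<Lambda> = (if \<Lambda> = 0 then Minf else Fin (Max (Poly_Mapping.keys \<Lambda>)))"

definition mat_min_deg :: "laurent^2^2 \<Rightarrow> int extended" where
  "mat_min_deg \<Lambda> = Min {min_deg (\<Lambda> $ i $ j) | i j. True}"

definition mat_max_deg :: "laurent^2^2 \<Rightarrow> int extended" where
  "mat_max_deg \<Lambda> = Max {max_deg (\<Lambda> $ i $ j) | i j. True}"


section \<open>The dual Garside structure\<close>

definition a\<^sub>1\<^sub>2 :: braid3 where "a\<^sub>1\<^sub>2 = \<sigma>\<^sub>1"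
definition a\<^sub>2\<^sub>3 :: braid3 where "a\<^sub>2\<^sub>3 = \<sigma>\<^sub>2"
definition a\<^sub>1\<^sub>3 :: braid3 where "a\<^sub>1\<^sub>3 = inverse \<sigma>\<^sub>1 * \<sigma>\<^sub>2 * \<sigma>\<^sub>1"
definition \<delta> :: braid3 where "\<delta> = \<sigma>\<^sub>2 * \<sigma>\<^sub>1"

inductive_set dual_monoid :: "braid3 set" where
  one: "1 \<in> dual_monoid"
| mult: "a \<in> {a\<^sub>1\<^sub>2, a\<^sub>2\<^sub>3, a\<^sub>1\<^sub>3} \<Longrightarrow> x \<in> dual_monoid \<Longrightarrow> a * x \<in> dual_monoid"

definition dual_le :: "braid3 \<Rightarrow> braid3 \<Rightarrow> bool" (infix \<open>\<preceq>\<^sub>d\<close> 50) where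
  "x \<preceq>\<^sub>d y \<longleftrightarrow> inverse x * y \<in> dual_monoid"

definition dual_simple :: "braid3 \<Rightarrow> bool" where
  "dual_simple d \<longleftrightarrow> 1 \<preceq>\<^sub>d d \<and> d \<preceq>\<^sub>d \<delta>"

definition is_dual_meet :: "braid3 \<Rightarrow> braid3 \<Rightarrow> braid3 \<Rightarrow> bool" where
  "is_dual_meet z x y \<longleftrightarrow>
     z \<preceq>\<^sub>d x \<and> z \<preceq>\<^sub>d y \<and> (\<forall>w. w \<preceq>\<^sub>d x \<and> w \<preceq>\<^sub>d y \<longrightarrow> w \<preceq>\<^sub>d z)"

definition left_weighted :: "braid3 \<Rightarrow> braid3 \<Rightarrow> bool" where
  "left_weighted d d' \<longleftrightarrow> is_dual_meet d \<delta> (d * d')"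

definition is_dual_nf :: "braid3 \<Rightarrow> int \<times> braid3 list \<Rightarrow> bool" where
  "is_dual_nf x = (\<lambda>(p, ds).
     x = \<delta> powi p * prod_list ds \<and>
     (\<forall>d\<in>set ds. dual_simple d) \<and>
     (ds \<noteq> [] \<longrightarrow> hd ds \<noteq> \<delta> \<and> last ds \<noteq> 1) \<and>
     (\<forall>i. Suc i < length ds \<longrightarrow> left_weighted (ds ! i) (ds ! Suc i)))"

text \<open>Every braid has exactly one dual normal form, so the description below is proper.\<close>

definition dual_nf :: "braid3 \<Rightarrow> int \<times> braid3 list" where
  "dual_nf x = (THE n. is_dual_nf x n)"

definition inf_d :: "braid3 \<Rightarrow> int" where
  "inf_d x = fst (dual_nf x)"

definition sup_d :: "braid3 \<Rightarrow> int" where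
  "sup_d x = fst (dual_nf x) + int (length (snd (dual_nf x)))"


section \<open>Algorithms\<close>

text \<open>Algorithms are Kleene's partial recursive functions: \<open>computes e xs y\<close> means that the
  function described by \<open>e\<close> is defined at the argument tuple \<open>xs\<close> with value \<open>y\<close>.\<close>

datatype recfn =
    Zero
  | Succ
  | Proj nat
  | Comp recfn "recfn list"
  | Prim recfn recfn
  | Mu recfn

inductive computes :: "recfn \<Rightarrow> nat list \<Rightarrow> nat \<Rightarrow> bool" where
  zero: "computes Zero xs 0"
| succ: "computes Succ [x] (Suc x)"
| proj: "i < length xs \<Longrightarrow> computes (Proj i) xs (xs ! i)"
| comp: "length ys = length gs \<Longrightarrow> (\<forall>i<length gs. computes (gs ! i) xs (ys ! i)) \<Longrightarrow>
    computes f ys z \<Longrightarrow> computes (Comp f gs) xs z"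
| prim_0: "computes f xs y \<Longrightarrow> computes (Prim f g) (0 # xs) y"
| prim_Suc: "computes (Prim f g) (n # xs) r \<Longrightarrow> computes g (n # r # xs) y \<Longrightarrow>
    computes (Prim f g) (Suc n # xs) y"
| mu: "computes f (n # xs) 0 \<Longrightarrow> (\<forall>m<n. \<exists>k. computes f (m # xs) (Suc k)) \<Longrightarrow>
    computes (Mu f) xs n"

lemma computes_deterministic: "computes e xs y \<Longrightarrow> computes e xs z \<Longrightarrow> y = z"
proof (induction arbitrary: z rule: computes.induct)
  case (zero xs)
  from zero.prems show ?case by (cases rule: computes.cases) auto
next
  case (succ x)
  from succ.prems show ?case by (cases rule: computes.cases) auto
next
  case (proj i xs)
  from proj.prems show ?case by (cases rule: computes.cases) auto
next
  case (prim_0 f xs y g)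
  from prim_0.prems have "computes f xs z" by (cases rule: computes.cases) auto
  with prim_0.IH show ?case by blast
next
  case (comp ys gs xs f y)
  from comp.prems obtain ys' where ys':
    "length ys' = length gs" "\<forall>i<length gs. computes (gs ! i) xs (ys' ! i)" "computes f ys' z"
    by (cases rule: computes.cases) auto
  have "ys = ys'" using comp.hyps comp.IH ys' by (auto intro!: nth_equalityI)
  with ys'(3) comp.IH show ?case by blast
next
  case (prim_Suc f g n xs r y)
  from prim_Suc.prems obtain r' where "computes (Prim f g) (n # xs) r'" "computes g (n # r' # xs) z"
    by (cases rule: computes.cases) auto
  with prim_Suc.IH show ?case by blast
next
  case (mu f n xs)
  from mu.prems have z: "computes f (z # xs) 0" "\<forall>m<z. \<exists>k. computes f (m # xs) (Suc k)"
    by (cases rule: computes.cases; simp)+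
  show ?case
  proof (cases n z rule: linorder_cases)
    case less
    with z(2) mu.IH show ?thesis by blast
  next
    case greater
    with z(1) mu.IH show ?thesis by blast
  qed
qed

text \<open>Inputs and outputs are finite data, coded as natural numbers by the library's encodings of
  integers, pairs and lists.  A Laurent polynomial is given as the list of its non-zero terms
  (exponent, coefficient), by increasing exponent.\<close>

definition laurent_code :: "laurent \<Rightarrow> nat" where
  "laurent_code \<Lambda> = list_encode
     (map (\<lambda>k. prod_encode (int_encode k, int_encode (Poly_Mapping.lookup \<Lambda> k)))
       (sorted_list_of_set (Poly_Mapping.keys \<Lambda>)))"

definition matrix_code :: "laurent^2^2 \<Rightarrow> nat" where
  "matrix_code \<Lambda> = list_encode
     [laurent_code (\<Lambda> $ 1 $ 1), laurent_code (\<Lambda> $ 1 $ 2),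
      laurent_code (\<Lambda> $ 2 $ 1), laurent_code (\<Lambda> $ 2 $ 2)]"

text \<open>An algorithm writes a normal form with symbols for the dual simple elements of the
  three-strand braid group, which are \<open>1\<close>, the three generators and \<open>\<delta>\<close>.\<close>

datatype simple_symbol = One | A12 | A23 | A13 | Delta

fun symbol_braid :: "simple_symbol \<Rightarrow> braid3" where
  "symbol_braid One = 1"
| "symbol_braid A12 = a\<^sub>1\<^sub>2"
| "symbol_braid A23 = a\<^sub>2\<^sub>3"
| "symbol_braid A13 = a\<^sub>1\<^sub>3"
| "symbol_braid Delta = \<delta>"

fun symbol_code :: "simple_symbol \<Rightarrow> nat" where
  "symbol_code One = 0"
| "symbol_code A12 = 1"
| "symbol_code A23 = 2"
| "symbol_code A13 = 3"
| "symbol_code Delta = 4"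

definition nf_code :: "int \<Rightarrow> simple_symbol list \<Rightarrow> nat" where
  "nf_code p w = prod_encode (int_encode p, list_encode (map symbol_code w))"

definition outputs_dual_nf :: "recfn \<Rightarrow> laurent^2^2 \<Rightarrow> int \<times> braid3 list \<Rightarrow> bool" where
  "outputs_dual_nf e \<Lambda> n \<longleftrightarrow>
     (\<exists>p w. n = (p, map symbol_braid w) \<and> computes e [matrix_code \<Lambda>] (nf_code p w))"

end

(*
Conjugation by delta permutes the three atoms cyclically, so every braid is delta^p times a word of
atoms in which no letter is followed by its complement.  Attach to the three atoms the vectors
f1 = C1, f2 = -C2, f3 = C2 - C1, where C1, C2 are the columns of the Burau matrix.  Right
multiplication by an atom keeps its own vector f, replaces the next one by q times the third, g, and
the third one by -f - q g.  Along a normal word there is therefore no cancellation: each letter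
raises the highest degree by one and leaves the lowest one unchanged, and the last letter is
determined by which of the three vectors loses its lowest term.  The last observation survives the
specialisation q = 3, read 3-adically, and multiplication by the row (1, -1).  Hence the normal form
is determined by two rational numbers, and the algorithm searches for the normal word producing them.
*)
theory Submission
  imports Defs
begin

text \<open>Specialising lets the search compare two integers instead of codes of Laurent matrices.
  The constants are nearly forced: the numbers that the identity attaches to the atoms sum to zero
  and must not be divisible by the prime. Three odd numbers cannot sum to zero, which excludes 2,
  and modulo 3 the row must be (1, -1) up to sign. The \<open>q\<close>-adic and the 3-adic readings
  are instances of one abstract argument, in which multiplication by \<open>q\<close> or by 3 shifts
  a filtration by one step.

  Uniqueness of the dual normal form comes from the same argument: a pair \<open>(p, w)\<close> is
  recovered from its vectors by reading off \<open>p\<close> and stripping letters from the end.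
  Identifying these pairs with dual normal forms relies on the exponent sum, which separates 1, the
  atoms and \<open>\<delta>\<close>.

  The obstacle in the search is that the power of \<open>\<delta>\<close> may be negative. It is
  repaired by powers of the cube of \<open>\<delta>\<close>, which acts as a scalar; the code of the
  input matrix is itself a sufficient number of cubes.\<close>

interpretation braid3: group "(*)" "1 :: braid3" inverse
  by standard (simp_all add: braid3_left_inverse)

lemma braid3_cancel:
  "x * (inverse x * y) = (y :: braid3)" "inverse x * (x * y) = y"
  by (simp_all add: mult.assoc[symmetric] braid3_right_inverse braid3_left_inverse)

lemma braid3_powi_plus_1: "(x :: braid3) powi (p + 1) = x powi p * x"
proof (cases "p \<ge> 0")
  case True
  then show ?thesis by (simp add: power_int_def nat_add_distrib power_Suc2 del: power_Suc)
next
  case False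
  define m where "m = nat (- p - 1)"
  have m: "nat (- p) = Suc m" "nat (- (p + 1)) = m" "p + 1 \<ge> 0 \<longleftrightarrow> p + 1 = 0" "p + 1 = 0 \<longleftrightarrow> m = 0"
    using False by (auto simp: m_def)
  show ?thesis
  proof (cases "m = 0")
    case True
    then have "p + 1 = 0" using m by simp
    then show ?thesis using m(1) True False by (simp add: power_int_def braid3_left_inverse)
  next
    case m0: False
    then have "\<not> p + 1 \<ge> 0" using m(3,4) by blast
    then show ?thesis using False m0 unfolding power_int_def m(1,2)
      by (simp add: power_Suc2 mult.assoc braid3_left_inverse del: power_Suc)
  qed
qed

lemma braid3_powi_minus_1: "(x :: braid3) powi (p - 1) = x powi p * inverse x"
  using braid3_powi_plus_1[of x "p - 1"]
  by (simp add: mult.assoc braid3_right_inverse)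


section \<open>Normal words\<close>

definition atoms :: "simple_symbol set" where
  "atoms = {A12, A23, A13}"

text \<open>\<open>nxt s\<close> is the right complement of the atom \<open>s\<close> in
  \<open>\<delta>\<close>: the three factorisations of \<open>\<delta>\<close> into atoms are
  \<open>s * nxt s\<close>. Fixing the two other symbols makes \<open>nxt\<close> a permutation of
  the whole type with trivial cube, so that its cancellation rules hold without side
  conditions.\<close>

fun nxt :: "simple_symbol \<Rightarrow> simple_symbol" where
  "nxt A23 = A12"
| "nxt A12 = A13"
| "nxt A13 = A23"
| "nxt s = s"

lemma nxt_nxt_nxt [simp]: "nxt (nxt (nxt s)) = s"
  by (cases s) auto

lemma nxt_in_atoms [simp]: "nxt s \<in> atoms \<longleftrightarrow> s \<in> atoms"
  by (cases s) (auto simp: atoms_def)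

lemma nxt_eq_iff [simp]: "nxt s = nxt t \<longleftrightarrow> s = t"
  by (metis nxt_nxt_nxt)

lemma atoms_cases: "s \<in> atoms \<Longrightarrow> t \<in> atoms \<Longrightarrow> t = s \<or> t = nxt s \<or> t = nxt (nxt s)"
  by (auto simp: atoms_def)

lemma ball_atoms: "s \<in> atoms \<Longrightarrow> (\<forall>t\<in>atoms. P t) \<longleftrightarrow> P s \<and> P (nxt s) \<and> P (nxt (nxt s))"
  by (auto simp: atoms_def)

lemma atoms_mult_nxt:
  assumes "s \<in> atoms"
  shows "symbol_braid s * symbol_braid (nxt s) = \<delta>"
proof -
  have "a\<^sub>1\<^sub>3 * a\<^sub>2\<^sub>3 = \<delta>"
    unfolding a\<^sub>1\<^sub>3_def a\<^sub>2\<^sub>3_def \<delta>_def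
    by (metis braid3_relation braid3_cancel(2) mult.assoc)
  moreover have "a\<^sub>1\<^sub>2 * a\<^sub>1\<^sub>3 = \<delta>"
    unfolding a\<^sub>1\<^sub>3_def a\<^sub>1\<^sub>2_def \<delta>_def by (simp add: mult.assoc braid3_cancel)
  ultimately show ?thesis
    using assms by (auto simp: atoms_def \<delta>_def a\<^sub>1\<^sub>2_def a\<^sub>2\<^sub>3_def)
qed

text \<open>Expand \<open>\<delta>\<close> as \<open>nxt s * nxt (nxt s)\<close> and regroup the
  first two factors \<open>s * nxt s\<close>.\<close>

lemma atoms_mult_delta:
  assumes "s \<in> atoms"
  shows "symbol_braid s * \<delta> = \<delta> * symbol_braid (nxt (nxt s))"
  using assms atoms_mult_nxt[of s] atoms_mult_nxt[of "nxt s"]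
  by (metis mult.assoc nxt_in_atoms)

lemma atoms_mult_inverse_delta:
  assumes "s \<in> atoms"
  shows "symbol_braid s * inverse \<delta> = inverse \<delta> * symbol_braid (nxt s)"
  using atoms_mult_delta[of "nxt s"] assms
  by (metis braid3_cancel(2) braid3_left_inverse mult.assoc mult.right_neutral nxt_in_atoms
      nxt_nxt_nxt braid3_right_inverse)

lemma inverse_atom:
  assumes "s \<in> atoms"
  shows "inverse (symbol_braid s) = symbol_braid (nxt s) * inverse \<delta>"
  by (metis assms atoms_mult_nxt braid3.inverse_unique braid3_right_inverse mult.assoc)

definition word_braid :: "simple_symbol list \<Rightarrow> braid3" where
  "word_braid w = prod_list (map symbol_braid w)"

lemma word_braid_simps [simp]:
  "word_braid [] = 1"
  "word_braid (s # w) = symbol_braid s * word_braid w"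
  "word_braid (v @ w) = word_braid v * word_braid w"
  by (simp_all add: word_braid_def)

definition garside :: "int \<Rightarrow> simple_symbol list \<Rightarrow> braid3" where
  "garside p w = \<delta> powi p * word_braid w"

definition normal_word :: "simple_symbol list \<Rightarrow> bool" where
  "normal_word w \<longleftrightarrow> set w \<subseteq> atoms \<and> successively (\<lambda>s t. t \<noteq> nxt s) w"

lemma normal_word_Nil [simp]: "normal_word []"
  by (simp add: normal_word_def)

lemma normal_word_snoc:
  "normal_word (w @ [s]) \<longleftrightarrow> normal_word w \<and> s \<in> atoms \<and> (w \<noteq> [] \<longrightarrow> s \<noteq> nxt (last w))"
  by (auto simp: normal_word_def successively_append_iff)

lemma normal_word_map_nxt [simp]: "normal_word (map nxt w) \<longleftrightarrow> normal_word w"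
  by (auto simp: normal_word_def successively_map)

lemma word_braid_delta:
  "set w \<subseteq> atoms \<Longrightarrow> word_braid w * \<delta> = \<delta> * word_braid (map nxt (map nxt w))"
proof (induction w)
  case (Cons s w)
  then show ?case by simp (metis atoms_mult_delta mult.assoc)
qed simp

lemma word_braid_inverse_delta:
  "set w \<subseteq> atoms \<Longrightarrow> word_braid w * inverse \<delta> = inverse \<delta> * word_braid (map nxt w)"
proof (induction w)
  case (Cons s w)
  then show ?case by simp (metis atoms_mult_inverse_delta mult.assoc)
qed simp

lemma garside_delta:
  "set w \<subseteq> atoms \<Longrightarrow> garside p w * \<delta> = garside (p + 1) (map nxt (map nxt w))"
  by (simp add: garside_def braid3_powi_plus_1 mult.assoc word_braid_delta del: map_map)

lemma garside_inverse_delta: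
  "set w \<subseteq> atoms \<Longrightarrow> garside p w * inverse \<delta> = garside (p - 1) (map nxt w)"
  by (simp add: garside_def braid3_powi_minus_1 mult.assoc word_braid_inverse_delta)

lemma garside_snoc: "garside p (w @ [s]) = garside p w * symbol_braid s"
  by (simp add: garside_def mult.assoc)

text \<open>At most one merge occurs: if \<open>s\<close> completes the last letter to
  \<open>\<delta>\<close>, that \<open>\<delta>\<close> moves to the front past a prefix which is
  only relabelled by \<open>nxt\<close> and so stays normal. The record of when the power grows
  later decides membership in the dual monoid.\<close>

lemma garside_mult_atom:
  assumes "normal_word w" "s \<in> atoms"
  shows "\<exists>p' w'. normal_word w' \<and> garside p w * symbol_braid s = garside p' w' \<and> p \<le> p' \<and>
    (p' = p \<or> (w \<noteq> [] \<and> s = nxt (last w) \<and> p' = p + 1))"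
proof (cases "w \<noteq> [] \<and> s = nxt (last w)")
  case False
  then have "normal_word (w @ [s])" using assms by (auto simp: normal_word_snoc)
  then show ?thesis by (metis garside_snoc order_refl)
next
  case True
  then obtain v where w: "w = v @ [last w]" by (metis append_butlast_last_id)
  then have v: "normal_word v" "last w \<in> atoms" using assms(1) by (metis normal_word_snoc)+
  have "garside p w * symbol_braid s = garside p v * \<delta>"
    using True v(2) by (subst w) (simp add: garside_snoc mult.assoc atoms_mult_nxt)
  also have "\<dots> = garside (p + 1) (map nxt (map nxt v))"
    using v(1) by (intro garside_delta) (simp add: normal_word_def)
  finally show ?thesis using True v(1)
    by (intro exI[of _ "p + 1"] exI[of _ "map nxt (map nxt v)"]) (simp del: map_map)
qed

text \<open>Induction over an Artin word. An inverse generator is an atom times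
  \<open>inverse \<delta>\<close>, which passes to the front of a word of atoms with a mere
  relabelling.\<close>

lemma ex_garside: "\<exists>p w. normal_word w \<and> x = garside p w"
proof -
  have "\<exists>p w. normal_word w \<and> abs_braid3 u = garside p w" for u
  proof (induction u rule: rev_induct)
    case Nil
    show ?case
      by (intro exI[of _ 0] exI[of _ "[]"])
        (simp add: garside_def one_braid3.abs_eq[symmetric])
  next
    case (snoc l u)
    then obtain p w where w: "normal_word w" "abs_braid3 u = garside p w" by blast
    have gen: "abs_braid3 [Pos S1] = symbol_braid A12" "abs_braid3 [Pos S2] = symbol_braid A23"
      by (simp_all add: a\<^sub>1\<^sub>2_def a\<^sub>2\<^sub>3_def \<sigma>\<^sub>1_def \<sigma>\<^sub>2_def)
    have inv: "abs_braid3 [Neg i] = inverse (abs_braid3 [Pos i])" for i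
      by (simp add: inverse_braid3.abs_eq word_inverse_def)
    have snoc: "abs_braid3 (u @ [l]) = garside p w * abs_braid3 [l]"
      by (simp add: times_braid3.abs_eq w(2)[symmetric])
    have "\<exists>s\<in>atoms. abs_braid3 [l] = symbol_braid s \<or> abs_braid3 [l] = inverse (symbol_braid s)"
      by (cases l; rename_tac i; case_tac i) (auto simp: gen inv atoms_def)
    then obtain s where s: "s \<in> atoms"
      "abs_braid3 [l] = symbol_braid s \<or> abs_braid3 [l] = symbol_braid (nxt s) * inverse \<delta>"
      using inverse_atom by metis
    from s(2) show ?case
    proof
      assume "abs_braid3 [l] = symbol_braid s"
      then show ?thesis using garside_mult_atom[OF w(1) s(1)] snoc by metis
    next
      assume l: "abs_braid3 [l] = symbol_braid (nxt s) * inverse \<delta>"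
      obtain p' w' where w': "normal_word w'" "garside p w * symbol_braid (nxt s) = garside p' w'"
        using garside_mult_atom[OF w(1), of "nxt s" p] s(1) unfolding nxt_in_atoms by blast
      have "abs_braid3 (u @ [l]) = garside (p' - 1) (map nxt w')"
        using w' by (simp add: snoc l mult.assoc[symmetric] garside_inverse_delta normal_word_def)
      then show ?thesis using w'(1) by (metis normal_word_map_nxt)
    qed
  qed
  then show ?thesis by (metis Quotient3_abs_rep Quotient3_braid3)
qed


section \<open>The ping-pong argument\<close>

text \<open>\<open>Y x s\<close> is the vector that the braid \<open>x\<close> attaches to the atom
  \<open>s\<close>, and \<open>T\<close> plays the role of \<open>q\<close>. The two instances are
  Laurent columns with multiplication by \<open>q\<close> and rationals with multiplication by 3.
  The update of the third vector follows from the zero sum.\<close>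

locale burau_action =
  fixes Y :: "braid3 \<Rightarrow> simple_symbol \<Rightarrow> 'a :: ab_group_add" and T :: "'a \<Rightarrow> 'a"
  assumes atom_fixed: "s \<in> atoms \<Longrightarrow> Y (x * symbol_braid s) s = Y x s"
    and atom_nxt: "s \<in> atoms \<Longrightarrow> Y (x * symbol_braid s) (nxt s) = T (Y x (nxt (nxt s)))"
    and delta_shift: "s \<in> atoms \<Longrightarrow> Y (x * \<delta>) s = T (Y x (nxt s))"
    and sum_zero: "Y x A23 + Y x A12 + Y x A13 = 0"
begin

lemma nxt_nxt_eq:
  assumes "s \<in> atoms"
  shows "Y x (nxt (nxt s)) = - Y x s - Y x (nxt s)"
proof -
  have "Y x s + Y x (nxt s) + Y x (nxt (nxt s)) = 0"
    using assms sum_zero[of x] unfolding atoms_def by (auto simp: add_ac)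
  then show ?thesis by (simp add: algebra_simps eq_neg_iff_add_eq_0)
qed

lemma atom_nxt_nxt:
  assumes "s \<in> atoms"
  shows "Y (x * symbol_braid s) (nxt (nxt s)) = - Y x s - T (Y x (nxt (nxt s)))"
  by (simp only: nxt_nxt_eq[OF assms, of "x * symbol_braid s"] atom_fixed[OF assms] atom_nxt[OF assms])

text \<open>\<open>\<delta>\<close> permutes the vectors and applies \<open>T\<close>, so all three
  move through the family \<open>D\<close> one step at a time. The truth value \<open>b\<close> lets
  one induction serve both membership and non-membership.\<close>

lemma delta_powi:
  fixes D :: "int \<Rightarrow> 'a set"
  assumes shift: "\<And>p y. T y \<in> D (p + 1) \<longleftrightarrow> y \<in> D p"
    and init: "\<And>s. s \<in> atoms \<Longrightarrow> (Y 1 s \<in> D r \<longleftrightarrow> b)"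
    and "s \<in> atoms"
  shows "Y (\<delta> powi p) s \<in> D (p + r) \<longleftrightarrow> b"
  using \<open>s \<in> atoms\<close>
proof (induction p arbitrary: s rule: int_induct[of _ 0])
  case base
  then show ?case by (simp add: init)
next
  case (step1 p)
  have "Y (\<delta> powi (p + 1)) s = T (Y (\<delta> powi p) (nxt s))"
    by (simp add: braid3_powi_plus_1 delta_shift step1.prems)
  then show ?case using step1.IH[of "nxt s"] step1.prems shift[of _ "p + r"]
    by (simp add: algebra_simps)
next
  case (step2 p)
  \<comment> \<open>Going down, the shift rule is read backwards: the atom whose successor is
    \<open>s\<close> is \<open>nxt (nxt s)\<close>.\<close>
  have "Y (\<delta> powi p) (nxt (nxt s)) = T (Y (\<delta> powi (p - 1)) s)"
    using braid3_powi_plus_1[of \<delta> "p - 1"] delta_shift[of "nxt (nxt s)" "\<delta> powi (p - 1)"] step2.prems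
    by simp
  then show ?case using step2.IH[of "nxt (nxt s)"] step2.prems shift[of _ "p - 1 + r"]
    by (simp add: algebra_simps)
qed

text \<open>\<open>D p\<close> stands for "order at least \<open>p\<close>". When
  \<open>a \<noteq> nxt (last w)\<close> is appended, the vector of \<open>a\<close> has order
  exactly \<open>p\<close> and is kept, that of \<open>nxt a\<close> becomes a
  \<open>T\<close>-image and rises, and in the third one the \<open>T\<close>-image lies too high to
  cancel the lowest term of \<open>- Y x a\<close>.\<close>

lemma lowest_term:
  fixes D :: "int \<Rightarrow> 'a set"
  assumes shift: "\<And>p y. T y \<in> D (p + 1) \<longleftrightarrow> y \<in> D p"
    and diff: "\<And>p y z. y \<in> D p \<Longrightarrow> z \<in> D p \<Longrightarrow> y - z \<in> D p"
    and mono: "\<And>p. D (p + 1) \<subseteq> D p"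
    and init: "\<And>s. s \<in> atoms \<Longrightarrow> Y 1 s \<in> D 0 \<and> Y 1 s \<notin> D 1"
    and "normal_word w"
  shows "\<forall>s\<in>atoms. Y (garside p w) s \<in> D p \<and>
    (Y (garside p w) s \<in> D (p + 1) \<longleftrightarrow> w \<noteq> [] \<and> s = nxt (last w))"
  using \<open>normal_word w\<close>
proof (induction w rule: rev_induct)
  case Nil
  have "Y (\<delta> powi p) s \<in> D p" "Y (\<delta> powi p) s \<notin> D (p + 1)" if "s \<in> atoms" for s
    using delta_powi[where D = D and r = 0 and b = True] delta_powi[where D = D and r = 1 and b = False]
      shift init that by auto
  then show ?case by (simp add: garside_def)
next
  case (snoc a w)
  then have a: "a \<in> atoms" "w \<noteq> [] \<Longrightarrow> a \<noteq> nxt (last w)" and w: "normal_word w"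
    by (auto simp: normal_word_snoc)
  note IH = snoc.IH[OF w]
  define x where "x = garside p w"
  have neg: "- y \<in> D n" if "y \<in> D n" for y n
    using diff[of y n y] diff[of "y - y" n y] that by simp
  have add: "y + z \<in> D n" if "y \<in> D n" "z \<in> D n" for y z n
    using diff[of y n "- z"] neg that by simp
  have a0: "Y x a \<in> D p" "Y x a \<notin> D (p + 1)"
    using IH a by (auto simp: x_def)
  have t: "T (Y x (nxt (nxt a))) \<in> D (p + 1)"
    using IH a(1) by (simp add: shift x_def)
  have "- Y x a - T (Y x (nxt (nxt a))) \<in> D p"
    using neg diff a0(1) t mono by blast
  moreover have "- Y x a - T (Y x (nxt (nxt a))) \<notin> D (p + 1)"
  proof
    assume "- Y x a - T (Y x (nxt (nxt a))) \<in> D (p + 1)"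
    from neg[OF add[OF this t]] a0(2) show False by simp
  qed
  moreover have "nxt a \<noteq> a" "nxt (nxt a) \<noteq> nxt a" using a(1) by (auto simp: atoms_def)
  ultimately show ?case
    using a0 t mono[of p] a(1) unfolding garside_snoc x_def[symmetric] ball_atoms[OF a(1)]
    by (auto simp: atom_fixed atom_nxt atom_nxt_nxt)
qed

text \<open>\<open>H N\<close> stands for "degree at most \<open>N\<close>". Here the vector of the
  last letter lags behind the two others, which share the top degree.\<close>

lemma highest_term:
  fixes H :: "int \<Rightarrow> 'a set"
  assumes shift: "\<And>p y. T y \<in> H (p + 1) \<longleftrightarrow> y \<in> H p"
    and diff: "\<And>p y z. y \<in> H p \<Longrightarrow> z \<in> H p \<Longrightarrow> y - z \<in> H p"
    and mono: "\<And>p. H p \<subseteq> H (p + 1)"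
    and init: "\<And>s. s \<in> atoms \<Longrightarrow> Y 1 s \<in> H 0 \<and> Y 1 s \<notin> H (- 1)"
    and "normal_word w"
  shows "\<forall>s\<in>atoms. Y (garside p w) s \<in> H (p + int (length w)) \<and>
    (Y (garside p w) s \<in> H (p + int (length w) - 1) \<longleftrightarrow> w \<noteq> [] \<and> s = last w)"
  using \<open>normal_word w\<close>
proof (induction w rule: rev_induct)
  case Nil
  have "Y (\<delta> powi p) s \<in> H p" "Y (\<delta> powi p) s \<notin> H (p - 1)" if "s \<in> atoms" for s
    using delta_powi[where D = H and r = 0 and b = True] delta_powi[where D = H and r = "-1" and b = False]
      shift init that by auto
  then show ?case by (simp add: garside_def)
next
  case (snoc a w)
  then have a: "a \<in> atoms" "w \<noteq> [] \<Longrightarrow> a \<noteq> nxt (last w)" and w: "normal_word w"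
    by (auto simp: normal_word_snoc)
  note IH = snoc.IH[OF w]
  define x where "x = garside p w"
  define N where "N = p + int (length w)"
  have N: "p + int (length (w @ [a])) = N + 1" by (simp add: N_def)
  have neg: "- y \<in> H n" if "y \<in> H n" for y n
    using diff[of y n y] diff[of "y - y" n y] that by simp
  have add: "y + z \<in> H n" if "y \<in> H n" "z \<in> H n" for y z n
    using diff[of y n "- z"] neg that by simp
  have a0: "Y x a \<in> H N"
    using IH a by (auto simp: x_def N_def)
  \<comment> \<open>Normality in the form used at the top: \<open>a \<noteq> nxt (last w)\<close>
    says that \<open>nxt (nxt a)\<close> is not the last letter, so its vector has full degree and
    its \<open>T\<close>-image dominates.\<close>
  have "Y x (nxt (nxt a)) \<in> H (N - 1) \<longleftrightarrow> w \<noteq> [] \<and> nxt (nxt a) = last w"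
    using IH a(1) by (auto simp: N_def x_def)
  then have "Y x (nxt (nxt a)) \<notin> H (N - 1)" using a(2) by (metis nxt_nxt_nxt)
  then have t: "T (Y x (nxt (nxt a))) \<in> H (N + 1)" "T (Y x (nxt (nxt a))) \<notin> H N"
    using IH a(1) shift[of _ "N - 1"] by (auto simp: shift x_def N_def)
  have "- Y x a - T (Y x (nxt (nxt a))) \<in> H (N + 1)"
    using neg diff a0(1) t mono by blast
  moreover have "- Y x a - T (Y x (nxt (nxt a))) \<notin> H N"
  proof
    assume "- Y x a - T (Y x (nxt (nxt a))) \<in> H N"
    from neg[OF add[OF this a0]] t(2) show False by simp
  qed
  moreover have "nxt a \<noteq> a" "nxt (nxt a) \<noteq> a" using a(1) by (auto simp: atoms_def)
  moreover have "Y x a \<in> H (N + 1)" using a0 mono by blast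
  ultimately show ?case
    using a0 t a(1) unfolding N garside_snoc x_def[symmetric] ball_atoms[OF a(1)]
    by (simp add: atom_fixed atom_nxt atom_nxt_nxt)
qed

text \<open>The lower filtration alone reconstructs the pair: \<open>p\<close> is the deepest step
  containing all three vectors, the only atom that can reach step \<open>p + 1\<close> is
  \<open>nxt\<close> of the last letter, and that letter can be stripped because \<open>T\<close> is
  injective.\<close>

lemma normal_form_eqI:
  fixes D :: "int \<Rightarrow> 'a set"
  assumes shift: "\<And>p y. T y \<in> D (p + 1) \<longleftrightarrow> y \<in> D p"
    and diff: "\<And>p y z. y \<in> D p \<Longrightarrow> z \<in> D p \<Longrightarrow> y - z \<in> D p"
    and mono: "\<And>p. D (p + 1) \<subseteq> D p"
    and init: "\<And>s. s \<in> atoms \<Longrightarrow> Y 1 s \<in> D 0 \<and> Y 1 s \<notin> D 1"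
    and "inj T"
    and "normal_word w" "normal_word w'"
    and "\<forall>s\<in>atoms. Y (garside p w) s = Y (garside p' w') s"
  shows "p = p' \<and> w = w'"
proof -
  have low: "\<forall>s\<in>atoms. Y (garside n v) s \<in> D n \<and>
    (Y (garside n v) s \<in> D (n + 1) \<longleftrightarrow> v \<noteq> [] \<and> s = nxt (last v))" if "normal_word v" for n v
    using shift diff mono init that by (rule lowest_term)
  have antimono: "D n \<subseteq> D m" if "m \<le> n" for m n
    using that by (induction rule: int_ge_induct) (use mono in blast)+
  have le: "n' \<le> n" if v: "normal_word v" "normal_word v'"
    "\<forall>s\<in>atoms. Y (garside n v) s = Y (garside n' v') s" for n n' v v'
  proof (rule ccontr)
    assume "\<not> n' \<le> n"
    then have "D n' \<subseteq> D (n + 1)" by (intro antimono) simp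
    have "s = nxt (last v)" if s: "s \<in> atoms" for s
    proof -
      have "Y (garside n v) s \<in> D n'" using low[OF v(2), of n'] v(3) s by simp
      then show ?thesis using \<open>D n' \<subseteq> D (n + 1)\<close> low[OF v(1), of n] s by blast
    qed
    \<comment> \<open>Two distinct atoms cannot both be \<open>nxt (last v)\<close>.\<close>
    from this[of A12] this[of A23] have "A12 = nxt (last v)" "A23 = nxt (last v)"
      by (simp_all add: atoms_def)
    then have "A12 = A23" by metis
    then show False by simp
  qed
  have "p = p'" using le assms(6-8) by (metis order_antisym)
  moreover have "w = w'"
    using assms(6-8) unfolding \<open>p = p'\<close>
  proof (induction w arbitrary: w' rule: rev_induct)
    case Nil
    show ?case
    proof (rule ccontr)
      assume "[] \<noteq> w'"
      \<comment> \<open>Then the vector of the atom \<open>nxt (last w')\<close> lies one step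
        deeper, whereas for the empty word no vector does.\<close>
      with Nil(2) have "last w' \<in> atoms" by (auto simp: normal_word_def)
      then show False
        using low[OF Nil(1), of p'] low[OF Nil(2), of p'] Nil(3) \<open>[] \<noteq> w'\<close> by auto
    qed
  next
    case (snoc a w)
    then have a: "a \<in> atoms" and w: "normal_word w" by (auto simp: normal_word_snoc)
    have "Y (garside p' w') (nxt a) \<in> D (p' + 1)"
      using low[OF snoc.prems(1), of p'] snoc.prems(3) a by auto
    then have last: "w' \<noteq> [] \<and> nxt a = nxt (last w')"
      using low[OF snoc.prems(2), of p'] a by (metis nxt_in_atoms)
    then obtain v where v: "w' = v @ [a]" by (metis append_butlast_last_id nxt_eq_iff)
    have nv: "normal_word v" using snoc.prems(2) v by (simp add: normal_word_snoc)
    define x y where "x = garside p' w" and "y = garside p' v"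
    have eq: "\<forall>s\<in>atoms. Y (x * symbol_braid a) s = Y (y * symbol_braid a) s"
      using snoc.prems(3) unfolding v garside_snoc x_def y_def .
    \<comment> \<open>Undoing the last letter: the vector of \<open>a\<close> was kept, that of
      \<open>nxt a\<close> is a \<open>T\<close>-image, and the remaining one comes from the zero
      sum.\<close>
    have "Y x a = Y y a" using eq a by (metis atom_fixed)
    moreover have "Y x (nxt (nxt a)) = Y y (nxt (nxt a))"
      using eq a atom_nxt[OF a] \<open>inj T\<close> by (metis injD nxt_in_atoms)
    moreover from this have "Y x (nxt a) = Y y (nxt a)"
      using nxt_nxt_eq[of "nxt (nxt a)" x] nxt_nxt_eq[of "nxt (nxt a)" y] a \<open>Y x a = Y y a\<close> by simp
    ultimately have "\<forall>s\<in>atoms. Y x s = Y y s"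
      using atoms_cases[OF a] by metis
    then show ?case using snoc.IH[OF w nv] by (simp add: x_def y_def v)
  qed
  ultimately show ?thesis ..
qed

end


section \<open>Columns of the Burau matrices\<close>

text \<open>The signs are such that the three columns sum to zero and that right multiplication by
  \<open>\<delta>\<close> turns the column of \<open>s\<close> into \<open>q\<close> times that of
  \<open>nxt s\<close>.\<close>

fun burau_column :: "laurent^2^2 \<Rightarrow> simple_symbol \<Rightarrow> laurent^2" where
  "burau_column X A23 = column 1 X"
| "burau_column X A12 = - column 2 X"
| "burau_column X A13 = column 2 X - column 1 X"
| "burau_column X s = 0"

lemma rho3_atoms:
  "\<rho>\<^sub>3 a\<^sub>1\<^sub>2 = vector [vector [- q, 0], vector [1, 1]]"
  "\<rho>\<^sub>3 a\<^sub>2\<^sub>3 = vector [vector [1, q], vector [0, - q]]"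
  "\<rho>\<^sub>3 a\<^sub>1\<^sub>3 = vector [vector [0, - 1], vector [- q, 1 - q]]"
  "\<rho>\<^sub>3 \<delta> = vector [vector [0, q], vector [- q, - q]]"
proof -
  show d: "\<rho>\<^sub>3 \<delta> = vector [vector [0, q], vector [- q, - q]]"
    by (simp add: \<delta>_def rho3_mult rho3_generators vec_eq_iff forall_2 matrix_matrix_mult_def sum_2)
  have "\<rho>\<^sub>3 (inverse \<sigma>\<^sub>1) = burau_letter (Neg S1)"
    by (simp add: \<sigma>\<^sub>1_def inverse_braid3.abs_eq word_inverse_def \<rho>\<^sub>3.abs_eq burau_word_simps
        del: burau_letter.simps)
  then show "\<rho>\<^sub>3 a\<^sub>1\<^sub>3 = vector [vector [0, - 1], vector [- q, 1 - q]]"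
    unfolding a\<^sub>1\<^sub>3_def mult.assoc \<delta>_def[symmetric] rho3_mult d
    by (simp add: vec_eq_iff forall_2 matrix_matrix_mult_def sum_2 q_q_inv)
qed (simp_all add: a\<^sub>1\<^sub>2_def a\<^sub>2\<^sub>3_def rho3_generators)

interpretation burau: burau_action "\<lambda>x. burau_column (\<rho>\<^sub>3 x)" "\<lambda>y. q *s y"
proof
  fix x s assume "s \<in> atoms"
  then show "burau_column (\<rho>\<^sub>3 (x * symbol_braid s)) s = burau_column (\<rho>\<^sub>3 x) s"
    "burau_column (\<rho>\<^sub>3 (x * symbol_braid s)) (nxt s) = q *s burau_column (\<rho>\<^sub>3 x) (nxt (nxt s))"
    "burau_column (\<rho>\<^sub>3 (x * \<delta>)) s = q *s burau_column (\<rho>\<^sub>3 x) (nxt s)"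
    by (auto simp: atoms_def rho3_mult rho3_atoms vec_eq_iff forall_2 matrix_matrix_mult_def sum_2
        column_def algebra_simps)
qed simp

lemma lookup_q_times: "Poly_Mapping.lookup (q * \<Lambda>) k = Poly_Mapping.lookup \<Lambda> (k - 1)" for \<Lambda> :: laurent
proof -
  have "k = 1 + r \<longleftrightarrow> r = k - 1" for r :: int by auto
  then have inner: "Sum_any (\<lambda>r. Poly_Mapping.lookup \<Lambda> r when k = 1 + r) = Poly_Mapping.lookup \<Lambda> (k - 1)"
    by simp
  have "Poly_Mapping.lookup (q * \<Lambda>) k =
      Sum_any (\<lambda>l. Sum_any (\<lambda>r. Poly_Mapping.lookup \<Lambda> r when k = l + r) when l = 1)"
    unfolding lookup_mult by (rule Sum_any.cong) (auto simp: q_def lookup_single when_def)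
  then show ?thesis using inner by simp
qed

text \<open>This and \<open>degree_le\<close> are the filtrations at \<open>q = 0\<close> and at
  infinity. Phrased by vanishing coefficients they are subgroups, and zero entries need no separate
  case.\<close>

definition order_ge :: "int \<Rightarrow> (laurent^2) set" where
  "order_ge p = {y. \<forall>i. \<forall>k<p. Poly_Mapping.lookup (y $ i) k = 0}"

definition degree_le :: "int \<Rightarrow> (laurent^2) set" where
  "degree_le N = {y. \<forall>i. \<forall>k>N. Poly_Mapping.lookup (y $ i) k = 0}"

lemma exists_2: "(\<exists>i::2. P i) \<longleftrightarrow> P 1 \<or> P 2"
  using forall_2[of "\<lambda>i. \<not> P i"] by auto

lemma burau_column_one:
  assumes "s \<in> atoms"
  shows "\<exists>i. Poly_Mapping.lookup (burau_column (mat 1) s $ i) 0 \<noteq> 0"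
    "k \<noteq> 0 \<Longrightarrow> Poly_Mapping.lookup (burau_column (mat 1) s $ i) k = 0"
  using assms
  by (auto simp: atoms_def column_def mat_def exists_2 lookup_one lookup_minus)

lemma order_ge_garside:
  assumes "normal_word w"
  shows "\<forall>s\<in>atoms. burau_column (\<rho>\<^sub>3 (garside p w)) s \<in> order_ge p \<and>
    (burau_column (\<rho>\<^sub>3 (garside p w)) s \<in> order_ge (p + 1) \<longleftrightarrow> w \<noteq> [] \<and> s = nxt (last w))"
proof (rule burau.lowest_term[OF _ _ _ _ assms])
  show "q *s y \<in> order_ge (p + 1) \<longleftrightarrow> y \<in> order_ge p" for p y
  proof -
    have "(\<forall>k<p + 1. Poly_Mapping.lookup \<Lambda> (k - 1) = 0) \<longleftrightarrow> (\<forall>k<p. Poly_Mapping.lookup \<Lambda> k = 0)" for \<Lambda> :: laurent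
      by (metis add_diff_cancel_right' diff_add_cancel less_diff_eq)
    then show ?thesis by (simp add: order_ge_def lookup_q_times)
  qed
  show "burau_column (\<rho>\<^sub>3 1) s \<in> order_ge 0 \<and> burau_column (\<rho>\<^sub>3 1) s \<notin> order_ge 1"
    if "s \<in> atoms" for s
    using burau_column_one[OF that] by (force simp: order_ge_def rho3_one)
qed (auto simp: order_ge_def lookup_minus)

lemma degree_le_garside:
  assumes "normal_word w"
  shows "\<forall>s\<in>atoms. burau_column (\<rho>\<^sub>3 (garside p w)) s \<in> degree_le (p + int (length w)) \<and>
    (burau_column (\<rho>\<^sub>3 (garside p w)) s \<in> degree_le (p + int (length w) - 1) \<longleftrightarrow> w \<noteq> [] \<and> s = last w)"
proof (rule burau.highest_term[OF _ _ _ _ assms])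
  show "q *s y \<in> degree_le (p + 1) \<longleftrightarrow> y \<in> degree_le p" for p y
  proof -
    have "(\<forall>k>p + 1. Poly_Mapping.lookup \<Lambda> (k - 1) = 0) \<longleftrightarrow> (\<forall>k>p. Poly_Mapping.lookup \<Lambda> k = 0)" for \<Lambda> :: laurent
      by (metis add_diff_cancel_right' diff_add_cancel less_diff_eq)
    then show ?thesis by (simp add: degree_le_def lookup_q_times)
  qed
  show "burau_column (\<rho>\<^sub>3 1) s \<in> degree_le 0 \<and> burau_column (\<rho>\<^sub>3 1) s \<notin> degree_le (- 1)"
    if "s \<in> atoms" for s
    using burau_column_one[OF that] by (force simp: degree_le_def rho3_one)
qed (auto simp: degree_le_def lookup_minus)

section \<open>Degrees of matrices from vanishing coefficients\<close>

lemma min_deg_ge: "\<forall>k<p. Poly_Mapping.lookup \<Lambda> k = 0 \<Longrightarrow> Fin p \<le> min_deg \<Lambda>"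
  by (auto simp: min_deg_def in_keys_iff not_less[symmetric] Min_less_iff)

lemma max_deg_le:
  assumes "\<forall>k>N. Poly_Mapping.lookup \<Lambda> k = 0"
  shows "max_deg \<Lambda> \<le> Fin N"
proof -
  have "\<forall>k\<in>Poly_Mapping.keys \<Lambda>. k \<le> N" using assms by (metis in_keys_iff not_le)
  then show ?thesis by (simp add: max_deg_def)
qed

lemma min_deg_le: "Poly_Mapping.lookup \<Lambda> p \<noteq> 0 \<Longrightarrow> min_deg \<Lambda> \<le> Fin p"
  by (auto simp: min_deg_def in_keys_iff)

lemma max_deg_ge: "Poly_Mapping.lookup \<Lambda> N \<noteq> 0 \<Longrightarrow> Fin N \<le> max_deg \<Lambda>"
  by (auto simp: max_deg_def in_keys_iff)

lemma finite_matrix_entries: "finite {f (\<Lambda> $ i $ j) | i j. True}" for \<Lambda> :: "'a^2^2"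
proof -
  have "{f (\<Lambda> $ i $ j) | i j. True} = (\<lambda>(i, j). f (\<Lambda> $ i $ j)) ` UNIV" by auto
  then show ?thesis by (metis finite_imageI finite_class.finite_UNIV)
qed

lemma mat_min_deg_eqI:
  assumes "\<forall>i j. \<forall>k<p. Poly_Mapping.lookup (\<Lambda> $ i $ j) k = 0"
    and "Poly_Mapping.lookup (\<Lambda> $ i $ j) p \<noteq> 0"
  shows "mat_min_deg \<Lambda> = Fin p"
  unfolding mat_min_deg_def
proof (rule Min_eqI[OF finite_matrix_entries])
  have "min_deg (\<Lambda> $ i $ j) = Fin p"
    using assms by (intro order_antisym min_deg_ge min_deg_le) auto
  then show "Fin p \<in> {min_deg (\<Lambda> $ i $ j) | i j. True}"
    unfolding mem_Collect_eq by (intro exI[of _ i] exI[of _ j]) simp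
qed (use assms(1) min_deg_ge in auto)

lemma mat_max_deg_eqI:
  assumes "\<forall>i j. \<forall>k>N. Poly_Mapping.lookup (\<Lambda> $ i $ j) k = 0"
    and "Poly_Mapping.lookup (\<Lambda> $ i $ j) N \<noteq> 0"
  shows "mat_max_deg \<Lambda> = Fin N"
  unfolding mat_max_deg_def
proof (rule Max_eqI[OF finite_matrix_entries])
  have "max_deg (\<Lambda> $ i $ j) = Fin N"
    using assms by (intro order_antisym max_deg_le max_deg_ge) auto
  then show "Fin N \<in> {max_deg (\<Lambda> $ i $ j) | i j. True}"
    unfolding mem_Collect_eq by (intro exI[of _ i] exI[of _ j]) simp
qed (use assms(1) max_deg_le in auto)

text \<open>Up to sign, the columns attached to \<open>A23\<close> and \<open>A12\<close> are those
  of the matrix. At most one atom gains an order, so one of these two columns has a nonzero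
  coefficient at exponent \<open>p\<close>.\<close>

lemma garside_min_deg:
  assumes "normal_word w"
  shows "mat_min_deg (\<rho>\<^sub>3 (garside p w)) = Fin p"
proof -
  let ?X = "\<rho>\<^sub>3 (garside p w)"
  have atoms: "A23 \<in> atoms" "A12 \<in> atoms" by (auto simp: atoms_def)
  note low = order_ge_garside[OF assms, of p]
  have "burau_column ?X A23 \<in> order_ge p" "burau_column ?X A12 \<in> order_ge p"
    using low atoms by auto
  then have zero: "\<forall>i j. \<forall>k<p. Poly_Mapping.lookup (?X $ i $ j) k = 0"
    by (auto simp: order_ge_def forall_2 column_def)
  have "burau_column ?X A23 \<notin> order_ge (p + 1) \<or> burau_column ?X A12 \<notin> order_ge (p + 1)"
    using low atoms by (metis simple_symbol.distinct(9))
  then obtain i j k where "k < p + 1" "Poly_Mapping.lookup (?X $ i $ j) k \<noteq> 0"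
    by (auto simp: order_ge_def column_def)
  moreover from this have "k = p" using zero by (metis linorder_neqE_linordered_idom zless_add1_eq)
  ultimately show ?thesis using zero mat_min_deg_eqI by blast
qed

text \<open>\<open>A23\<close> and \<open>A12\<close> are not both the last letter, so one of the
  two columns attains the top degree.\<close>

lemma garside_max_deg:
  assumes "normal_word w"
  shows "mat_max_deg (\<rho>\<^sub>3 (garside p w)) = Fin (p + int (length w))"
proof -
  let ?X = "\<rho>\<^sub>3 (garside p w)" and ?N = "p + int (length w)"
  have atoms: "A23 \<in> atoms" "A12 \<in> atoms" by (auto simp: atoms_def)
  note high = degree_le_garside[OF assms, of p]
  have "burau_column ?X A23 \<in> degree_le ?N" "burau_column ?X A12 \<in> degree_le ?N"
    using high atoms by auto
  then have zero: "\<forall>i j. \<forall>k>?N. Poly_Mapping.lookup (?X $ i $ j) k = 0"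
    by (auto simp: degree_le_def forall_2 column_def)
  have "burau_column ?X A23 \<notin> degree_le (?N - 1) \<or> burau_column ?X A12 \<notin> degree_le (?N - 1)"
    using high atoms by (metis simple_symbol.distinct(9))
  then obtain i j k where "k > ?N - 1" "Poly_Mapping.lookup (?X $ i $ j) k \<noteq> 0"
    by (auto simp: degree_le_def column_def)
  moreover from this have "k = ?N" using zero by (metis linorder_neqE_linordered_idom zle_diff1_eq not_le)
  ultimately show ?thesis using zero mat_max_deg_eqI by blast
qed


section \<open>Specialisation at three\<close>

definition eval3 :: "laurent \<Rightarrow> rat" where
  "eval3 \<Lambda> = (\<Sum>k\<in>Poly_Mapping.keys \<Lambda>. of_int (Poly_Mapping.lookup \<Lambda> k) * 3 powi k)"

lemma eval3_superset:
  assumes "finite S" "Poly_Mapping.keys \<Lambda> \<subseteq> S"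
  shows "eval3 \<Lambda> = (\<Sum>k\<in>S. of_int (Poly_Mapping.lookup \<Lambda> k) * 3 powi k)"
  unfolding eval3_def using assms
  by (intro sum.mono_neutral_left) (auto simp: in_keys_iff)

lemma eval3_diff: "eval3 (\<Lambda> - \<Lambda>') = eval3 \<Lambda> - eval3 \<Lambda>'"
proof -
  define S where "S = Poly_Mapping.keys \<Lambda> \<union> Poly_Mapping.keys \<Lambda>'"
  have "eval3 \<Lambda>'' = (\<Sum>k\<in>S. of_int (Poly_Mapping.lookup \<Lambda>'' k) * 3 powi k)"
    if "\<Lambda>'' \<in> {\<Lambda>, \<Lambda>', \<Lambda> - \<Lambda>'}" for \<Lambda>''
    using that by (intro eval3_superset) (auto simp: S_def in_keys_iff lookup_minus)
  then show ?thesis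
    by (simp add: lookup_minus sum_subtractf left_diff_distrib)
qed

lemma eval3_0 [simp]: "eval3 0 = 0"
  by (simp add: eval3_def)

lemma eval3_1 [simp]: "eval3 1 = 1"
  by (simp add: eval3_def)

lemma eval3_q_times: "eval3 (q * \<Lambda>) = 3 * eval3 \<Lambda>"
proof -
  have "Poly_Mapping.keys (q * \<Lambda>) = (\<lambda>k. k + 1) ` Poly_Mapping.keys \<Lambda>"
    by (force simp: in_keys_iff lookup_q_times image_iff)
  then have "eval3 (q * \<Lambda>) =
      (\<Sum>k\<in>Poly_Mapping.keys \<Lambda>. of_int (Poly_Mapping.lookup \<Lambda> k) * 3 powi (k + 1))"
    by (simp add: eval3_def sum.reindex inj_on_def lookup_q_times)
  also have "\<dots> = 3 * eval3 \<Lambda>"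
    by (simp add: eval3_def sum_distrib_left power_int_add algebra_simps)
  finally show ?thesis .
qed

text \<open>Modulo three, the row \<open>(1, -1)\<close> pairs to \<open>1\<close> with the columns attached to all three atoms, so it
  is in general position for the ping-pong argument.\<close>

definition row_eval :: "laurent^2 \<Rightarrow> rat" where
  "row_eval y = eval3 (y $ 1) - eval3 (y $ 2)"

lemma row_eval_simps:
  "row_eval 0 = 0"
  "row_eval (y - z) = row_eval y - row_eval z"
  "row_eval (- y) = - row_eval y"
  "row_eval (y + z) = row_eval y + row_eval z"
  "row_eval (q *s y) = 3 * row_eval y"
proof -
  show diff: "row_eval (y - z) = row_eval y - row_eval z" for y z
    by (simp add: row_eval_def eval3_diff)
  show zero: "row_eval 0 = 0" by (simp add: row_eval_def)
  show "row_eval (- y) = - row_eval y" for y using diff[of 0 y] zero by simp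
  then show "row_eval (y + z) = row_eval y + row_eval z" using diff[of y "- z"] by simp
  show "row_eval (q *s y) = 3 * row_eval y" by (simp add: row_eval_def eval3_q_times)
qed

interpretation burau3: burau_action "\<lambda>x s. row_eval (burau_column (\<rho>\<^sub>3 x) s)" "\<lambda>y. 3 * y"
proof
  fix x
  show "row_eval (burau_column (\<rho>\<^sub>3 x) A23) + row_eval (burau_column (\<rho>\<^sub>3 x) A12) +
      row_eval (burau_column (\<rho>\<^sub>3 x) A13) = 0"
    using burau.sum_zero[of x] by (metis row_eval_simps(1,4))
qed (simp_all add: burau.atom_fixed burau.atom_nxt burau.delta_shift row_eval_simps)

lemma normal_form_eqI:
  assumes "normal_word w" "normal_word w'"
    and "\<forall>s\<in>atoms. row_eval (burau_column (\<rho>\<^sub>3 (garside p w)) s) =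
      row_eval (burau_column (\<rho>\<^sub>3 (garside p' w')) s)"
  shows "p = p' \<and> w = w'"
proof -
  \<comment> \<open>The 3-adic filtration. Integer multiples of \<open>3 powi p\<close> suffice,
    since integral Laurent polynomials at 3 have only powers of 3 as denominators.\<close>
  define D :: "int \<Rightarrow> rat set" where "D p = range (\<lambda>z. 3 powi p * of_int z)" for p
  show ?thesis
  proof (rule burau3.normal_form_eqI[of D, OF _ _ _ _ _ assms])
    show "3 * y \<in> D (p + 1) \<longleftrightarrow> y \<in> D p" for p y
      by (auto simp: D_def power_int_add image_iff)
    show "y - z \<in> D p" if yz: "y \<in> D p" "z \<in> D p" for p y z
    proof -
      obtain m n where "y = 3 powi p * of_int m" "z = 3 powi p * of_int n"
        using yz unfolding D_def by blast
      then have "y - z = 3 powi p * of_int (m - n)" by (simp add: algebra_simps)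
      then show ?thesis unfolding D_def by blast
    qed
    show "D (p + 1) \<subseteq> D p" for p
    proof
      fix y assume "y \<in> D (p + 1)"
      then obtain m where "y = 3 powi (p + 1) * of_int m" by (auto simp: D_def)
      then have "y = 3 powi p * of_int (3 * m)" by (simp add: power_int_add)
      then show "y \<in> D p" unfolding D_def by blast
    qed
    show "inj (\<lambda>y :: rat. 3 * y)" by (simp add: inj_def)
    show "row_eval (burau_column (\<rho>\<^sub>3 1) s) \<in> D 0 \<and> row_eval (burau_column (\<rho>\<^sub>3 1) s) \<notin> D 1"
      if "s \<in> atoms" for s
    proof -
      have "row_eval (column 1 (mat 1)) = 1" "row_eval (column 2 (mat 1)) = - 1"
        by (simp_all add: row_eval_def column_def mat_def)
      \<comment> \<open>The value is 1 at \<open>A23\<close> and \<open>A12\<close> and -2 at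
        \<open>A13\<close>, so always 1 modulo 3.\<close>
      then have "row_eval (burau_column (\<rho>\<^sub>3 1) s) \<in> {of_int 1, of_int (- 2)}"
        using that by (auto simp: atoms_def rho3_one row_eval_simps)
      moreover have "of_int m \<in> D 0" for m by (auto simp: D_def)
      moreover have "of_int m \<in> D 1 \<longleftrightarrow> 3 dvd m" for m
      proof -
        have "(of_int m :: rat) = 3 * of_int z \<longleftrightarrow> m = 3 * z" for z
          by (metis of_int_eq_iff of_int_mult of_int_numeral)
        then show ?thesis by (auto simp: D_def image_iff)
      qed
      moreover have "\<not> 3 dvd (1 :: int)" "\<not> 3 dvd (- 2 :: int)" by simp_all
      ultimately show ?thesis by (metis insertE singletonD)
    qed
  qed
qed

text \<open>Equal braids have equal row values. With \<open>ex_garside\<close>, every braid thus has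
  exactly one such pair.\<close>

lemma garside_eq_iff:
  assumes "normal_word w" "normal_word w'"
  shows "garside p w = garside p' w' \<longleftrightarrow> p = p' \<and> w = w'"
  using normal_form_eqI[OF assms] by metis


section \<open>Dual normal forms\<close>

text \<open>The abelianisation of the braid group. It takes the values 0, 1 and 2 on 1, the atoms
  and \<open>\<delta>\<close>, and counts the letters of a word of atoms.\<close>

lift_definition exponent_sum :: "braid3 \<Rightarrow> int"
  is "\<lambda>u. \<Sum>l\<leftarrow>u. case l of Pos _ \<Rightarrow> 1 | Neg _ \<Rightarrow> - 1"
proof -
  fix u v :: "letter list"
  assume "braid_eq u v"
  then show "(\<Sum>l\<leftarrow>u. case l of Pos _ \<Rightarrow> 1 | Neg _ \<Rightarrow> - 1) =
      (\<Sum>l\<leftarrow>v. case l of Pos _ \<Rightarrow> 1 | Neg _ \<Rightarrow> (- 1 :: int))"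
    by (induction rule: braid_eq.induct) auto
qed

lemma exponent_sum_mult: "exponent_sum (x * y) = exponent_sum x + exponent_sum y"
  by transfer simp

lemma exponent_sum_one [simp]: "exponent_sum 1 = 0"
  by transfer simp

lemma exponent_sum_inverse: "exponent_sum (inverse x) = - exponent_sum x"
  using exponent_sum_mult[of "inverse x" x] by (simp add: braid3_left_inverse)

lemma exponent_sum_symbol:
  "s \<in> atoms \<Longrightarrow> exponent_sum (symbol_braid s) = 1"
  "exponent_sum \<delta> = 2"
proof -
  have "exponent_sum \<sigma>\<^sub>1 = 1" "exponent_sum \<sigma>\<^sub>2 = 1" by (transfer, simp)+
  then show "s \<in> atoms \<Longrightarrow> exponent_sum (symbol_braid s) = 1" "exponent_sum \<delta> = 2"
    by (auto simp: atoms_def a\<^sub>1\<^sub>2_def a\<^sub>2\<^sub>3_def a\<^sub>1\<^sub>3_def \<delta>_def exponent_sum_mult exponent_sum_inverse)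
qed

lemma exponent_sum_word:
  "set w \<subseteq> atoms \<Longrightarrow> exponent_sum (word_braid w) = int (length w)"
  by (induction w) (auto simp: exponent_sum_mult exponent_sum_symbol)

section \<open>The dual monoid and its simple elements\<close>

lemma dual_monoid_iff_word: "x \<in> dual_monoid \<longleftrightarrow> (\<exists>w. set w \<subseteq> atoms \<and> x = word_braid w)"
proof
  assume "x \<in> dual_monoid"
  then show "\<exists>w. set w \<subseteq> atoms \<and> x = word_braid w"
  proof induction
    case one
    show ?case by (intro exI[of _ "[]"]) simp
  next
    case (mult a x)
    then obtain w where "set w \<subseteq> atoms" "x = word_braid w" by blast
    moreover from mult(1) have "a \<in> symbol_braid ` atoms" by (auto simp: atoms_def)
    then obtain s where "s \<in> atoms" "a = symbol_braid s" by blast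
    ultimately show ?case by (intro exI[of _ "s # w"]) simp
  qed
next
  assume "\<exists>w. set w \<subseteq> atoms \<and> x = word_braid w"
  then obtain w where "set w \<subseteq> atoms" "x = word_braid w" by blast
  then show "x \<in> dual_monoid"
    by (induction w arbitrary: x) (auto simp: atoms_def intro: dual_monoid.intros)
qed

lemma dual_monoid_mult: "x \<in> dual_monoid \<Longrightarrow> y \<in> dual_monoid \<Longrightarrow> x * y \<in> dual_monoid"
  unfolding dual_monoid_iff_word by (metis le_sup_iff set_append word_braid_simps(3))

lemma symbol_in_dual_monoid: "symbol_braid s \<in> dual_monoid"
proof -
  have gen: "a \<in> dual_monoid" if "a \<in> {a\<^sub>1\<^sub>2, a\<^sub>2\<^sub>3, a\<^sub>1\<^sub>3}" for a
    using dual_monoid.mult[OF that dual_monoid.one] by simp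
  have "\<delta> = a\<^sub>2\<^sub>3 * a\<^sub>1\<^sub>2" by (simp add: \<delta>_def a\<^sub>1\<^sub>2_def a\<^sub>2\<^sub>3_def)
  moreover have "a\<^sub>2\<^sub>3 * a\<^sub>1\<^sub>2 \<in> dual_monoid"
    by (rule dual_monoid_mult) (rule gen, simp)+
  ultimately have "\<delta> \<in> dual_monoid" by metis
  then show ?thesis using gen by (cases s) (simp_all add: dual_monoid.one)
qed

text \<open>For the forward direction, a word of atoms is normalised letter by letter from power 0;
  \<open>garside_mult_atom\<close> never lowers the power, and uniqueness identifies the final power
  with \<open>p\<close>.\<close>

lemma garside_in_dual_monoid_iff:
  assumes "normal_word w"
  shows "garside p w \<in> dual_monoid \<longleftrightarrow> p \<ge> 0"
proof
  assume "p \<ge> 0"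
  have "\<delta> ^ n \<in> dual_monoid" for n
    using symbol_in_dual_monoid[of Delta]
    by (induction n) (auto intro: dual_monoid.one dual_monoid_mult)
  moreover have "word_braid w \<in> dual_monoid"
    using assms dual_monoid_iff_word by (auto simp: normal_word_def)
  ultimately show "garside p w \<in> dual_monoid"
    using \<open>p \<ge> 0\<close> by (auto simp: garside_def power_int_def intro: dual_monoid_mult)
next
  assume "garside p w \<in> dual_monoid"
  then obtain v where v: "set v \<subseteq> atoms" "garside p w = word_braid v"
    by (auto simp: dual_monoid_iff_word)
  from v(1) have "\<exists>p' w'. p' \<ge> 0 \<and> normal_word w' \<and> word_braid v = garside p' w'"
  proof (induction v rule: rev_induct)
    case Nil
    show ?case by (intro exI[of _ 0] exI[of _ "[]"]) (simp add: garside_def)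
  next
    case (snoc s v)
    then obtain p' w' where w': "p' \<ge> 0" "normal_word w'" "word_braid v = garside p' w'" by auto
    moreover have "s \<in> atoms" using snoc.prems by simp
    ultimately show ?case
      using garside_mult_atom[OF w'(2) \<open>s \<in> atoms\<close>, of p'] by simp (metis order_trans)
  qed
  then show "p \<ge> 0" using v(2) garside_eq_iff[OF assms] by metis
qed

text \<open>\<open>d\<close> and its complement in \<open>\<delta>\<close> are words of atoms whose
  lengths add up to 2, so one of them is empty or \<open>d\<close> is a single letter.\<close>

lemma dual_simple_cases:
  assumes "dual_simple d"
  obtains s where "d = symbol_braid s"
proof -
  obtain v w where v: "set v \<subseteq> atoms" "d = word_braid v"
    and w: "set w \<subseteq> atoms" "inverse d * \<delta> = word_braid w"
    using assms unfolding dual_simple_def dual_le_def dual_monoid_iff_word by auto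
  have "int (length v) + int (length w) = exponent_sum d + exponent_sum (inverse d * \<delta>)"
    using exponent_sum_word[OF v(1)] exponent_sum_word[OF w(1)] unfolding v(2)[symmetric] w(2)[symmetric]
    by simp
  also have "\<dots> = 2" by (simp add: exponent_sum_mult exponent_sum_inverse exponent_sum_symbol)
  finally consider "v = []" | s where "v = [s]" | "w = []"
    by (cases v; cases "tl v"; cases w) auto
  then show thesis
  proof cases
    case 1
    then show thesis using v that[of One] by simp
  next
    case 2
    then show thesis using v that by simp
  next
    case 3
    then have "d = \<delta>" using w(2) by (metis braid3_cancel(1) mult.right_neutral word_braid_simps(1))
    then show thesis using that[of Delta] by simp
  qed
qed

section \<open>Left-weighted pairs\<close>

lemma dual_le_refl: "x \<preceq>\<^sub>d x"
  by (simp add: dual_le_def braid3_left_inverse dual_monoid.one)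

lemma dual_monoid_exponent_sum: "x \<in> dual_monoid \<Longrightarrow> exponent_sum x \<ge> 0"
  using dual_monoid_iff_word exponent_sum_word by force

lemma dual_simple_symbol: "dual_simple (symbol_braid s)"
proof -
  have "\<exists>t. inverse (symbol_braid s) * \<delta> = symbol_braid t"
  proof (cases "s \<in> atoms")
    case True
    then show ?thesis using atoms_mult_nxt braid3_cancel(2) by metis
  next
    case False
    then have "inverse (symbol_braid s) * \<delta> = symbol_braid (if s = One then Delta else One)"
      by (cases s) (auto simp: atoms_def braid3_left_inverse)
    then show ?thesis ..
  qed
  then have "inverse (symbol_braid s) * \<delta> \<in> dual_monoid" using symbol_in_dual_monoid by metis
  then show ?thesis using symbol_in_dual_monoid by (simp add: dual_simple_def dual_le_def)
qed

text \<open>The second factor is itself a common lower bound of \<open>\<delta>\<close> and the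
  product, so it lies below 1 and has exponent sum at most 0.\<close>

lemma left_weighted_one:
  assumes "left_weighted 1 (symbol_braid s)"
  shows "symbol_braid s = 1"
proof -
  have "symbol_braid s \<preceq>\<^sub>d 1"
    using assms dual_simple_symbol[of s] dual_le_refl
    by (auto simp: left_weighted_def is_dual_meet_def dual_simple_def)
  then have "exponent_sum (symbol_braid s) \<le> 0"
    using dual_monoid_exponent_sum by (fastforce simp: dual_le_def exponent_sum_inverse)
  then show ?thesis
    using exponent_sum_symbol(1)[of s] exponent_sum_symbol(2)
    by (cases s) (auto simp: atoms_def)
qed

text \<open>Here the meet would have to be above \<open>\<delta>\<close>, which exponent sums forbid
  for an atom.\<close>

lemma not_left_weighted_delta:
  assumes "s \<in> atoms" "\<delta> \<preceq>\<^sub>d symbol_braid s * d"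
  shows "\<not> left_weighted (symbol_braid s) d"
proof
  assume "left_weighted (symbol_braid s) d"
  then have "\<delta> \<preceq>\<^sub>d symbol_braid s"
    using assms(2) dual_le_refl by (auto simp: left_weighted_def is_dual_meet_def)
  then show False
    using dual_monoid_exponent_sum[of "inverse \<delta> * symbol_braid s"] assms(1)
    by (simp add: dual_le_def exponent_sum_mult exponent_sum_inverse exponent_sum_symbol)
qed

lemma left_weighted_atoms_iff:
  assumes "s \<in> atoms" "t \<in> atoms"
  shows "left_weighted (symbol_braid s) (symbol_braid t) \<longleftrightarrow> t \<noteq> nxt s"
proof
  assume "left_weighted (symbol_braid s) (symbol_braid t)"
  then show "t \<noteq> nxt s"
    using not_left_weighted_delta[OF assms(1)] atoms_mult_nxt[OF assms(1)] dual_le_refl by metis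
next
  assume t: "t \<noteq> nxt s"
  show "left_weighted (symbol_braid s) (symbol_braid t)"
    unfolding left_weighted_def is_dual_meet_def
  proof (intro conjI allI impI)
    show "symbol_braid s \<preceq>\<^sub>d \<delta>" using dual_simple_symbol by (simp add: dual_simple_def)
    show "symbol_braid s \<preceq>\<^sub>d symbol_braid s * symbol_braid t"
      by (simp add: dual_le_def braid3_cancel symbol_in_dual_monoid)
    fix z assume z: "z \<preceq>\<^sub>d \<delta> \<and> z \<preceq>\<^sub>d symbol_braid s * symbol_braid t"
    \<comment> \<open>The bounds on \<open>z\<close> say that \<open>y\<close> enters the dual
      monoid after multiplication by \<open>nxt s\<close> and by \<open>t\<close>. If the power
      \<open>p\<close> of \<open>y\<close> were negative, both atoms would have to raise it; only
      \<open>nxt (last w)\<close> can, which would force \<open>t = nxt s\<close>.\<close>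
    define y where "y = inverse z * symbol_braid s"
    obtain p w where w: "normal_word w" "y = garside p w" using ex_garside by blast
    have "y * symbol_braid (nxt s) \<in> dual_monoid" "y * symbol_braid t \<in> dual_monoid"
      using z by (simp_all add: y_def dual_le_def mult.assoc atoms_mult_nxt assms(1))
    moreover have "u = nxt (last w)"
      if u: "u \<in> atoms" "y * symbol_braid u \<in> dual_monoid" "p < 0" for u
    proof -
      obtain p' w' where w': "normal_word w'" "y * symbol_braid u = garside p' w'"
        "p' = p \<or> u = nxt (last w)"
        using garside_mult_atom[OF w(1) u(1), of p] w(2) by blast
      then show ?thesis using u(2,3) garside_in_dual_monoid_iff[OF w'(1)] by auto
    qed
    ultimately have "p \<ge> 0" using assms t by (metis not_le nxt_in_atoms)
    then show "z \<preceq>\<^sub>d symbol_braid s"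
      using garside_in_dual_monoid_iff[OF w(1)] w(2) by (simp add: dual_le_def y_def)
  qed
qed

lemma symbol_ne_one_delta:
  "s \<in> atoms \<Longrightarrow> symbol_braid s \<noteq> 1" "s \<in> atoms \<Longrightarrow> symbol_braid s \<noteq> \<delta>" "\<delta> \<noteq> 1"
  using exponent_sum_symbol by force+

lemma is_dual_nf_garside:
  assumes "normal_word w"
  shows "is_dual_nf (garside p w) (p, map symbol_braid w)"
proof -
  have w: "set w \<subseteq> atoms" "successively (\<lambda>s t. t \<noteq> nxt s) w"
    using assms by (auto simp: normal_word_def)
  have "left_weighted (map symbol_braid w ! i) (map symbol_braid w ! Suc i)"
    if "Suc i < length w" for i
    using that w successively_nth[OF w(2) that] left_weighted_atoms_iff[of "w ! i" "w ! Suc i"]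
    by (simp add: subset_iff)
  moreover have "w \<noteq> [] \<Longrightarrow> hd w \<in> atoms \<and> last w \<in> atoms"
    using w(1) by auto
  ultimately show ?thesis
    using symbol_ne_one_delta
    by (auto simp: is_dual_nf_def garside_def word_braid_def dual_simple_symbol hd_map last_map)
qed

lemma is_dual_nf_normal_word:
  assumes "is_dual_nf x (p, ds)"
  obtains w where "normal_word w" "ds = map symbol_braid w" "x = garside p w"
proof -
  have simple: "dual_simple d" if "d \<in> set ds" for d using assms that by (auto simp: is_dual_nf_def)
  then have "\<exists>w. ds = map symbol_braid w"
    by (metis dual_simple_cases ex_map_conv)
  then obtain w where w: "ds = map symbol_braid w" by blast
  have lw: "left_weighted (symbol_braid (w ! i)) (symbol_braid (w ! Suc i))"
    if "Suc i < length w" for i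
    using assms that by (auto simp: is_dual_nf_def w)
  \<comment> \<open>By \<open>left_weighted_one\<close> a trivial letter forces the next one to be
    trivial, up to the last letter; hence the induction down from the end.\<close>
  have no_one: "symbol_braid (w ! i) \<noteq> 1" if "i < length w" for i
  proof -
    have "i \<le> length w - 1" using that by simp
    then show ?thesis
    proof (induction rule: inc_induct)
      case base
      have "ds \<noteq> []" using that w by auto
      then show ?case using assms by (auto simp: is_dual_nf_def w last_conv_nth)
    next
      case (step n)
      then show ?case using lw[of n] left_weighted_one by (metis Suc_lessI less_diff_conv add_0 plus_1_eq_Suc add.commute)
    qed
  qed
  \<comment> \<open>An atom followed by \<open>\<delta>\<close> is not left-weighted, because
    \<open>\<delta>\<close> moves past the atom and divides the product. So the absence of
    \<open>\<delta>\<close> propagates from the first letter.\<close>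
  have no_delta: "symbol_braid (w ! i) \<noteq> \<delta>" if "i < length w" for i
    using that
  proof (induction i)
    case 0
    then have "ds \<noteq> []" using w by auto
    then show ?case using assms by (auto simp: is_dual_nf_def w hd_conv_nth)
  next
    case (Suc i)
    have "w ! i \<in> atoms"
      using no_one[of i] Suc by (cases "w ! i") (auto simp: atoms_def)
    then have "\<delta> \<preceq>\<^sub>d symbol_braid (w ! i) * \<delta>"
      using symbol_in_dual_monoid by (simp add: atoms_mult_delta dual_le_def braid3_cancel)
    then show ?case
      using not_left_weighted_delta \<open>w ! i \<in> atoms\<close> lw Suc.prems by metis
  qed
  have atoms: "w ! i \<in> atoms" if "i < length w" for i
    using no_one[OF that] no_delta[OF that] by (cases "w ! i") (auto simp: atoms_def)
  then have "normal_word w"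
    using lw left_weighted_atoms_iff
    by (auto simp: normal_word_def successively_conv_nth set_conv_nth)
  then show thesis using that w assms by (auto simp: is_dual_nf_def garside_def word_braid_def)
qed

lemma dual_nf_garside:
  assumes "normal_word w"
  shows "dual_nf (garside p w) = (p, map symbol_braid w)"
  unfolding dual_nf_def
proof (rule the_equality)
  show "is_dual_nf (garside p w) (p, map symbol_braid w)"
    using assms by (rule is_dual_nf_garside)
  fix n assume "is_dual_nf (garside p w) n"
  then obtain p' w' where "normal_word w'" "n = (p', map symbol_braid w')" "garside p w = garside p' w'"
    using is_dual_nf_normal_word by (metis surj_pair)
  then show "n = (p, map symbol_braid w)" using garside_eq_iff[OF assms] by metis
qed


section \<open>Total recursive functions\<close>

text \<open>Stated for functions on lists of a fixed length instead of programs, so that closure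
  rules follow the shape of the term and programs are assembled by resolution with
  \<open>recursive_intros\<close>.\<close>

definition recursive :: "nat \<Rightarrow> (nat list \<Rightarrow> nat) \<Rightarrow> bool" where
  "recursive k f \<longleftrightarrow> (\<exists>e. \<forall>xs. length xs = k \<longrightarrow> computes e xs (f xs))"

named_theorems recursive_intros

lemma recursive_cong:
  assumes "recursive k f" "\<And>xs. length xs = k \<Longrightarrow> f xs = g xs"
  shows "recursive k g"
  using assms unfolding recursive_def by metis

lemma recursive_nth [recursive_intros]: "i < k \<Longrightarrow> recursive k (\<lambda>xs. xs ! i)"
  unfolding recursive_def by (metis computes.proj)

lemma recursive_compose:
  assumes "recursive (length fs) g" "\<forall>f\<in>set fs. recursive k f"
  shows "recursive k (\<lambda>xs. g (map (\<lambda>f. f xs) fs))"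
proof -
  obtain e where e: "\<And>xs. length xs = length fs \<Longrightarrow> computes e xs (g xs)"
    using assms(1) unfolding recursive_def by blast
  obtain E where E: "\<And>f xs. f \<in> set fs \<Longrightarrow> length xs = k \<Longrightarrow> computes (E f) xs (f xs)"
    using assms(2) unfolding recursive_def by metis
  have "computes (Comp e (map E fs)) xs (g (map (\<lambda>f. f xs) fs))" if "length xs = k" for xs
    using that by (intro computes.comp[where ys = "map (\<lambda>f. f xs) fs"]) (auto intro: e E)
  then show ?thesis unfolding recursive_def by blast
qed

lemma recursive_Suc [recursive_intros]:
  assumes "recursive k f"
  shows "recursive k (\<lambda>xs. Suc (f xs))"
proof -
  have "recursive 1 (\<lambda>xs. Suc (hd xs))"
    unfolding recursive_def
    by (intro exI[of _ Succ]) (auto simp: length_Suc_conv intro: computes.succ)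
  then show ?thesis
    using recursive_compose[of "[f]" "\<lambda>xs. Suc (hd xs)" k] assms by simp
qed

lemma recursive_const [recursive_intros]: "recursive k (\<lambda>_. c)"
proof (induction c)
  case 0
  show ?case unfolding recursive_def by (metis computes.zero)
qed (rule recursive_Suc)

text \<open>\<open>Prim\<close> recurses on its first argument; composing it with \<open>n\<close>
  and the projections allows a computed bound while all inputs stay available as parameters.\<close>

lemma recursive_rec_nat:
  assumes "recursive k f" "recursive (Suc (Suc k)) g" "recursive k n"
  shows "recursive k (\<lambda>xs. rec_nat (f xs) (\<lambda>m r. g (m # r # xs)) (n xs))"
proof -
  obtain e where e: "\<And>xs. length xs = k \<Longrightarrow> computes e xs (f xs)"
    using assms(1) unfolding recursive_def by blast
  obtain d where d: "\<And>xs. length xs = Suc (Suc k) \<Longrightarrow> computes d xs (g xs)"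
    using assms(2) unfolding recursive_def by blast
  have rec: "computes (Prim e d) (m # xs) (rec_nat (f xs) (\<lambda>m r. g (m # r # xs)) m)"
    if "length xs = k" for m xs
  proof (induction m)
    case (Suc m)
    show ?case using computes.prim_Suc[OF Suc d] that by simp
  qed (use that e computes.prim_0 in simp)
  define h where "h ys = rec_nat (f (tl ys)) (\<lambda>m r. g (m # r # tl ys)) (hd ys)" for ys
  define fs where "fs = n # map (\<lambda>i xs. xs ! i) [0..<k]"
  have "computes (Prim e d) ys (h ys)" if "length ys = Suc k" for ys
    using that by (cases ys) (auto simp: h_def rec)
  then have "recursive (length fs) h"
    unfolding recursive_def fs_def by auto
  moreover have "\<forall>f\<in>set fs. recursive k f"
    using assms(3) by (auto simp: fs_def intro: recursive_nth)
  ultimately have "recursive k (\<lambda>xs. h (map (\<lambda>f. f xs) fs))" by (rule recursive_compose)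
  moreover have "h (map (\<lambda>f. f xs) fs) = rec_nat (f xs) (\<lambda>m r. g (m # r # xs)) (n xs)"
    if "length xs = k" for xs
  proof -
    have "map (\<lambda>i. xs ! i) [0..<k] = xs" using that map_nth by blast
    then show ?thesis by (simp add: h_def fs_def o_def)
  qed
  ultimately show ?thesis by (rule recursive_cong)
qed

text \<open>The step of \<open>Prim\<close> receives counter, accumulator and parameters;
  projections drop the counter.\<close>

lemma recursive_iterate:
  assumes "recursive k f" "recursive (Suc k) (\<lambda>xs. g (xs ! 0) (tl xs))" "recursive k n"
  shows "recursive k (\<lambda>xs. ((\<lambda>r. g r xs) ^^ n xs) (f xs))"
proof -
  have "recursive (Suc (Suc k)) (\<lambda>ys. (\<lambda>xs. g (xs ! 0) (tl xs)) (map (\<lambda>f. f ys) (map (\<lambda>i xs. xs ! Suc i) [0..<Suc k])))"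
    using assms(2) by (intro recursive_compose) (auto intro!: recursive_nth)
  then have "recursive (Suc (Suc k)) (\<lambda>ys. g (ys ! 1) (drop 2 ys))"
  proof (rule recursive_cong)
    fix ys :: "nat list"
    assume "length ys = Suc (Suc k)"
    moreover from this have "map (\<lambda>i. ys ! Suc i) [0..<Suc k] = tl ys"
      by (intro nth_equalityI) (auto simp: nth_tl simp del: upt_Suc)
    ultimately show "(\<lambda>xs. g (xs ! 0) (tl xs)) (map (\<lambda>f. f ys) (map (\<lambda>i xs. xs ! Suc i) [0..<Suc k])) =
        g (ys ! 1) (drop 2 ys)"
      by (simp add: o_def nth_tl drop_Suc numeral_2_eq_2 del: upt_Suc)
  qed
  from recursive_rec_nat[OF assms(1) this assms(3)] show ?thesis
  proof (rule recursive_cong)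
    show "rec_nat (f xs) (\<lambda>m r. g ((m # r # xs) ! 1) (drop 2 (m # r # xs))) (n xs) =
        ((\<lambda>r. g r xs) ^^ n xs) (f xs)" for xs
    proof -
      have "rec_nat a (\<lambda>m r. g r xs) m = ((\<lambda>r. g r xs) ^^ m) a" for m a
        by (induction m) auto
      then show ?thesis by simp
    qed
  qed
qed

lemma recursive_add [recursive_intros]:
  assumes "recursive k f" "recursive k g"
  shows "recursive k (\<lambda>xs. f xs + g xs)"
proof -
  have "recursive k (\<lambda>xs. ((\<lambda>r. Suc r) ^^ g xs) (f xs))"
    by (rule recursive_iterate[where g = "\<lambda>r _. Suc r"]) (intro recursive_intros assms; simp)+
  moreover have "(Suc ^^ m) a = a + m" for m a by (induction m) auto
  ultimately show ?thesis by (simp add: add.commute)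
qed

lemma recursive_pred:
  assumes "recursive k f"
  shows "recursive k (\<lambda>xs. f xs - 1)"
proof -
  have "recursive k (\<lambda>xs. rec_nat 0 (\<lambda>m r. (m # r # xs) ! 0) (f xs))"
    by (rule recursive_rec_nat) (intro recursive_intros assms; simp)+
  moreover have "rec_nat 0 (\<lambda>m r. (m # r # xs) ! 0) n = n - 1" for n xs by (cases n) auto
  ultimately show ?thesis by simp
qed

lemma recursive_diff [recursive_intros]:
  assumes "recursive k f" "recursive k g"
  shows "recursive k (\<lambda>xs. f xs - g xs)"
proof -
  have "recursive k (\<lambda>xs. ((\<lambda>r. r - 1) ^^ g xs) (f xs))"
    by (rule recursive_iterate[where g = "\<lambda>r _. r - 1"]) (intro recursive_pred recursive_intros assms; simp)+
  moreover have "((\<lambda>r. r - 1) ^^ m) a = a - m" for m a :: nat by (induction m) auto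
  ultimately show ?thesis by simp
qed

lemma recursive_weaken:
  assumes "recursive k f"
  shows "recursive (Suc k) (\<lambda>ys. f (tl ys))"
proof -
  have "recursive (Suc k) (\<lambda>ys. f (map (\<lambda>h. h ys) (map (\<lambda>i xs. xs ! Suc i) [0..<k])))"
    using assms by (intro recursive_compose) (auto intro!: recursive_nth)
  then show ?thesis
  proof (rule recursive_cong)
    fix ys :: "nat list"
    assume "length ys = Suc k"
    then have "map (\<lambda>i. ys ! Suc i) [0..<k] = tl ys"
      by (intro nth_equalityI) (auto simp: nth_tl)
    then show "f (map (\<lambda>h. h ys) (map (\<lambda>i xs. xs ! Suc i) [0..<k])) = f (tl ys)"
      by (simp add: o_def)
  qed
qed

lemma recursive_mult [recursive_intros]:
  assumes "recursive k f" "recursive k g"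
  shows "recursive k (\<lambda>xs. f xs * g xs)"
proof -
  have "recursive k (\<lambda>xs. ((\<lambda>r. r + f xs) ^^ g xs) 0)"
    by (rule recursive_iterate[where g = "\<lambda>r xs. r + f xs"])
      (intro recursive_intros recursive_weaken assms; simp)+
  moreover have "((\<lambda>r. r + b) ^^ m) 0 = b * m" for m b :: nat by (induction m) auto
  ultimately show ?thesis by simp
qed

lemma recursive_power [recursive_intros]:
  assumes "recursive k f" "recursive k g"
  shows "recursive k (\<lambda>xs. f xs ^ g xs)"
proof -
  have "recursive k (\<lambda>xs. ((\<lambda>r. f xs * r) ^^ g xs) 1)"
    by (rule recursive_iterate[where g = "\<lambda>r xs. f xs * r"])
      (intro recursive_intros recursive_weaken assms; simp)+
  moreover have "((\<lambda>r. b * r) ^^ m) 1 = b ^ m" for m b :: nat by (induction m) auto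
  ultimately show ?thesis by simp
qed

section \<open>Decidable predicates, parity and halving\<close>

abbreviation recursive_pred_on :: "nat \<Rightarrow> (nat list \<Rightarrow> bool) \<Rightarrow> bool" where
  "recursive_pred_on k P \<equiv> recursive k (\<lambda>xs. of_bool (P xs))"

lemma recursive_eq_0:
  assumes "recursive k f"
  shows "recursive_pred_on k (\<lambda>xs. f xs = 0)"
proof -
  have "recursive k (\<lambda>xs. 1 - f xs)" by (intro recursive_intros assms)
  then show ?thesis by (rule recursive_cong) auto
qed

lemma recursive_not [recursive_intros]:
  assumes "recursive_pred_on k P"
  shows "recursive_pred_on k (\<lambda>xs. \<not> P xs)"
  using recursive_eq_0[OF assms] by simp

lemma recursive_conj [recursive_intros]:
  assumes "recursive_pred_on k P" "recursive_pred_on k Q"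
  shows "recursive_pred_on k (\<lambda>xs. P xs \<and> Q xs)"
  using recursive_mult[OF assms] by (simp flip: of_bool_conj)

lemma recursive_disj [recursive_intros]:
  assumes "recursive_pred_on k P" "recursive_pred_on k Q"
  shows "recursive_pred_on k (\<lambda>xs. P xs \<or> Q xs)"
  using recursive_not[OF recursive_conj[OF recursive_not recursive_not, OF assms]] by simp

lemma recursive_le [recursive_intros]:
  assumes "recursive k f" "recursive k g"
  shows "recursive_pred_on k (\<lambda>xs. f xs \<le> g xs)"
  using recursive_eq_0[OF recursive_diff[OF assms]] by simp

lemma recursive_eq [recursive_intros]:
  assumes "recursive k f" "recursive k g"
  shows "recursive_pred_on k (\<lambda>xs. f xs = g xs)"
  using recursive_conj[OF recursive_le recursive_le, OF assms assms(2,1)]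
  by (simp add: order_eq_iff)

lemma recursive_If [recursive_intros]:
  assumes "recursive_pred_on k P" "recursive k f" "recursive k g"
  shows "recursive k (\<lambda>xs. if P xs then f xs else g xs)"
proof -
  have "recursive k (\<lambda>xs. of_bool (P xs) * f xs + of_bool (\<not> P xs) * g xs)"
    by (intro recursive_intros assms)
  then show ?thesis by (rule recursive_cong) auto
qed

text \<open>Parity is the iterated flip \<open>1 - r\<close>, and half of \<open>n\<close> counts
  the odd numbers below \<open>n\<close>.\<close>

lemma recursive_mod2_div2:
  assumes "recursive k f"
  shows recursive_mod2 [recursive_intros]: "recursive k (\<lambda>xs. f xs mod 2)"
    and recursive_div2 [recursive_intros]: "recursive k (\<lambda>xs. f xs div 2)"
proof -
  have mod: "recursive k (\<lambda>xs. g xs mod 2)" if g: "recursive k g" for k and g :: "nat list \<Rightarrow> nat"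
  proof -
    have "recursive k (\<lambda>xs. ((\<lambda>r. 1 - r) ^^ g xs) 0)"
      by (rule recursive_iterate[where g = "\<lambda>r _. 1 - r"]) (intro recursive_intros g; simp)+
    moreover have "((\<lambda>r. 1 - r) ^^ m) 0 = m mod 2" for m :: nat
      by (induction m) (auto simp: mod_Suc)
    ultimately show ?thesis by simp
  qed
  show "recursive k (\<lambda>xs. f xs mod 2)" using mod assms .
  have "recursive k (\<lambda>xs. rec_nat 0 (\<lambda>m r. (m # r # xs) ! 1 + (m # r # xs) ! 0 mod 2) (f xs))"
    by (rule recursive_rec_nat) (intro recursive_intros assms mod; simp)+
  moreover have "rec_nat 0 (\<lambda>m r. (m # r # xs) ! 1 + (m # r # xs) ! 0 mod 2) n = n div 2" for n xs
    by (induction n) (auto, presburger)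
  ultimately show "recursive k (\<lambda>xs. f xs div 2)" by simp
qed

lemma recursive_even [recursive_intros]:
  "recursive k f \<Longrightarrow> recursive_pred_on k (\<lambda>xs. even (f xs))"
  using recursive_eq_0[OF recursive_mod2] by (simp add: even_iff_mod_2_eq_zero)


section \<open>Recursive functions on codes of pairs, lists and integers\<close>

lemma recursive_triangle [recursive_intros]:
  "recursive k f \<Longrightarrow> recursive k (\<lambda>xs. triangle (f xs))"
  unfolding triangle_def by (intro recursive_intros)

lemma recursive_prod_encode [recursive_intros]:
  "recursive k f \<Longrightarrow> recursive k g \<Longrightarrow> recursive k (\<lambda>xs. prod_encode (f xs, g xs))"
  unfolding prod_encode_def prod.case by (intro recursive_intros)

text \<open>The diagonal on which a number lies in the Cantor enumeration of pairs.\<close>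

definition diagonal :: "nat \<Rightarrow> nat" where
  "diagonal = rec_nat 0 (\<lambda>m r. if triangle (Suc r) \<le> Suc m then Suc r else r)"

lemma diagonal_bounds: "triangle (diagonal n) \<le> n \<and> n < triangle (Suc (diagonal n))"
proof (induction n)
  case (Suc n)
  have "diagonal (Suc n) = (if triangle (Suc (diagonal n)) \<le> Suc n then Suc (diagonal n) else diagonal n)"
    by (simp add: diagonal_def)
  then show ?case using Suc by (cases "triangle (Suc (diagonal n)) \<le> Suc n") auto
qed (simp add: diagonal_def)

lemma triangle_mono: "m \<le> n \<Longrightarrow> triangle m \<le> triangle n"
  by (rule lift_Suc_mono_le[of triangle]) auto

lemma diagonal_prod_encode: "diagonal (prod_encode (a, b)) = a + b"
proof (rule ccontr)
  let ?n = "prod_encode (a, b)"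
  assume "diagonal ?n \<noteq> a + b"
  then consider "Suc (diagonal ?n) \<le> a + b" | "Suc (a + b) \<le> diagonal ?n" by linarith
  moreover have "triangle (a + b) \<le> ?n" "?n < triangle (Suc (a + b))" by (auto simp: prod_encode_def)
  ultimately show False
    using diagonal_bounds[of ?n] triangle_mono by cases (metis leD le_trans)+
qed

lemma recursive_diagonal [recursive_intros]:
  assumes "recursive k f"
  shows "recursive k (\<lambda>xs. diagonal (f xs))"
proof -
  have "recursive k (\<lambda>xs. rec_nat 0 (\<lambda>m r. if triangle (Suc ((m # r # xs) ! 1)) \<le> Suc ((m # r # xs) ! 0)
      then Suc ((m # r # xs) ! 1) else (m # r # xs) ! 1) (f xs))"
    by (rule recursive_rec_nat) (intro recursive_intros assms; simp)+
  then show ?thesis by (simp add: diagonal_def cong: if_cong)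
qed

text \<open>The Cantor code of \<open>(a, b)\<close> is \<open>triangle (a + b) + a\<close>, so the
  diagonal \<open>a + b\<close> gives both components by subtraction.\<close>

lemma prod_decode_diagonal:
  "fst (prod_decode n) = n - triangle (diagonal n)"
  "snd (prod_decode n) = diagonal n - fst (prod_decode n)"
proof -
  obtain a b where n: "n = prod_encode (a, b)" by (metis prod_decode_inverse surj_pair)
  then show "fst (prod_decode n) = n - triangle (diagonal n)"
    by (simp add: diagonal_prod_encode) (simp add: prod_encode_def)
  show "snd (prod_decode n) = diagonal n - fst (prod_decode n)"
    by (simp add: n diagonal_prod_encode)
qed

lemma recursive_fst [recursive_intros]:
  "recursive k f \<Longrightarrow> recursive k (\<lambda>xs. fst (prod_decode (f xs)))"
  unfolding prod_decode_diagonal by (intro recursive_intros)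

lemma recursive_snd [recursive_intros]:
  "recursive k f \<Longrightarrow> recursive k (\<lambda>xs. snd (prod_decode (f xs)))"
  unfolding prod_decode_diagonal(2) by (intro recursive_intros)

text \<open>A nonempty list is coded by the successor of the code of its head and tail. On the empty
  list, truncated subtraction and \<open>prod_decode 0 = (0, 0)\<close> give the empty list
  again.\<close>

definition tail_code :: "nat \<Rightarrow> nat" where
  "tail_code l = snd (prod_decode (l - 1))"

lemma tail_code_list_encode: "tail_code (list_encode xs) = list_encode (tl xs)"
proof (cases xs)
  case Nil
  have "prod_decode 0 = (0, 0)" using prod_encode_inverse[of "(0, 0)"] by (simp add: prod_encode_def)
  with Nil show ?thesis by (simp add: tail_code_def)
qed (simp add: tail_code_def)

lemma list_encode_drop: "(tail_code ^^ i) (list_encode xs) = list_encode (drop i xs)"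
  by (induction i) (auto simp: tail_code_list_encode drop_Suc tl_drop)

lemma hd_list_encode: "xs \<noteq> [] \<Longrightarrow> fst (prod_decode (list_encode xs - Suc 0)) = hd xs"
  by (cases xs) auto

lemma length_le_list_encode: "length xs \<le> list_encode xs"
  by (induction xs) (auto intro: le_trans[OF _ le_prod_encode_2])

lemma recursive_tail_code [recursive_intros]:
  "recursive k f \<Longrightarrow> recursive k (\<lambda>xs. tail_code (f xs))"
  unfolding tail_code_def by (intro recursive_intros)

lemma recursive_drop_code:
  assumes "recursive k f" "recursive k g"
  shows "recursive k (\<lambda>xs. (tail_code ^^ g xs) (f xs))"
  by (rule recursive_iterate[where g = "\<lambda>r _. tail_code r"]) (intro recursive_intros assms; simp)+

text \<open>The code of a list bounds its length and so serves as the number of rounds. Round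
  \<open>m\<close> reads the head of the \<open>m\<close>-th tail; past the end the tail code is 0
  and the accumulator is kept.\<close>

lemma recursive_fold:
  assumes a: "recursive k a" and l: "recursive k l"
    and g: "recursive (Suc (Suc k)) (\<lambda>xs. g (xs ! 0) (xs ! 1) (drop 2 xs))"
  shows "recursive k (\<lambda>xs. fold (\<lambda>x r. g x r xs) (list_decode (l xs)) (a xs))"
proof -
  define t where "t ys = (tail_code ^^ (ys ! 0)) (l (drop 2 ys))" for ys
  have drop2: "tl (tl ys) = drop 2 ys" for ys :: "nat list" by (simp add: drop_Suc numeral_2_eq_2)
  have t: "recursive (Suc (Suc k)) t"
    unfolding t_def drop2[symmetric]
    using recursive_weaken[OF recursive_weaken[OF l]]
    by (intro recursive_drop_code recursive_intros) auto
  define fs where "fs = (\<lambda>ys. fst (prod_decode (t ys - 1))) # map (\<lambda>i ys. ys ! Suc i) [0..<Suc k]"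
  have "recursive (Suc (Suc k))
      (\<lambda>ys. (\<lambda>xs. g (xs ! 0) (xs ! 1) (drop 2 xs)) (map (\<lambda>f. f ys) fs))"
    using g t by (intro recursive_compose) (auto simp: fs_def intro!: recursive_intros)
  then have "recursive (Suc (Suc k)) (\<lambda>ys. if t ys = 0 then ys ! 1
      else (\<lambda>xs. g (xs ! 0) (xs ! 1) (drop 2 xs)) (map (\<lambda>f. f ys) fs))"
    by (intro recursive_intros t) auto
  from recursive_rec_nat[OF a this l] show ?thesis
  proof (rule recursive_cong)
    fix xs :: "nat list" assume xs: "length xs = k"
    define ws where "ws = list_decode (l xs)"
    have lws: "l xs = list_encode ws" by (simp add: ws_def)
    have tm: "t (m # r # xs) = list_encode (drop m ws)" for m r
      by (simp add: t_def lws list_encode_drop)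
    have fsm: "map (\<lambda>f. f (m # r # xs)) fs = fst (prod_decode (list_encode (drop m ws) - 1)) # r # xs" for m r
    proof -
      have "map (\<lambda>i. (m # r # xs) ! Suc i) [0..<Suc k] = r # xs"
        using xs by (intro nth_equalityI) (auto simp: nth_Cons' simp del: upt_Suc)
      then show ?thesis by (simp add: fs_def tm o_def del: upt_Suc)
    qed
    have z: "list_encode ys = 0 \<longleftrightarrow> ys = []" for ys by (cases ys) auto
    have "rec_nat (a xs) (\<lambda>m r. if t (m # r # xs) = 0 then (m # r # xs) ! 1
        else (\<lambda>xs. g (xs ! 0) (xs ! 1) (drop 2 xs)) (map (\<lambda>f. f (m # r # xs)) fs)) n =
        fold (\<lambda>x r. g x r xs) (take n ws) (a xs)" for n
    proof (induction n)
      case (Suc n)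
      show ?case
      proof (cases "n < length ws")
        case True
        then have "list_encode (drop n ws) \<noteq> 0" "hd (drop n ws) = ws ! n"
          by (auto simp: z hd_drop_conv_nth)
        then show ?thesis using True Suc
          by (simp add: tm fsm hd_list_encode z take_Suc_conv_app_nth)
      qed (use Suc in \<open>simp add: tm\<close>)
    qed simp
    then show "rec_nat (a xs) (\<lambda>m r. if t (m # r # xs) = 0 then (m # r # xs) ! 1
        else (\<lambda>xs. g (xs ! 0) (xs ! 1) (drop 2 xs)) (map (\<lambda>f. f (m # r # xs)) fs)) (l xs) =
        fold (\<lambda>x r. g x r xs) (list_decode (l xs)) (a xs)"
      using length_le_list_encode[of ws] by (simp add: lws)
  qed
qed

text \<open>Programs handle natural numbers only, so an integer is computed through its positive and
  negative parts.\<close>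

definition recursive_int :: "nat \<Rightarrow> (nat list \<Rightarrow> int) \<Rightarrow> bool" where
  "recursive_int k f \<longleftrightarrow> recursive k (\<lambda>xs. nat (f xs)) \<and> recursive k (\<lambda>xs. nat (- f xs))"

lemma recursive_int_of_nat [recursive_intros]:
  "recursive k f \<Longrightarrow> recursive_int k (\<lambda>xs. int (f xs))"
  by (simp add: recursive_int_def recursive_const)

lemma recursive_int_const [recursive_intros]: "recursive_int k (\<lambda>_. c)"
  by (simp add: recursive_int_def recursive_const)

lemma recursive_int_minus [recursive_intros]:
  "recursive_int k f \<Longrightarrow> recursive_int k (\<lambda>xs. - f xs)"
  by (simp add: recursive_int_def)

lemma recursive_int_diff_nat:
  assumes "recursive k f" "recursive k g"
  shows "recursive_int k (\<lambda>xs. int (f xs) - int (g xs))"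
proof -
  have "nat (int (f xs) - int (g xs)) = f xs - g xs"
    "nat (- (int (f xs) - int (g xs))) = g xs - f xs" for xs by auto
  then show ?thesis
    unfolding recursive_int_def by (simp only:) (intro conjI recursive_intros assms)
qed

lemma recursive_int_add [recursive_intros]:
  assumes "recursive_int k f" "recursive_int k g"
  shows "recursive_int k (\<lambda>xs. f xs + g xs)"
proof -
  have "recursive_int k (\<lambda>xs. int (nat (f xs) + nat (g xs)) - int (nat (- f xs) + nat (- g xs)))"
    using assms unfolding recursive_int_def[of k f] recursive_int_def[of k g]
    by (intro recursive_int_diff_nat recursive_intros) auto
  moreover have "int (nat a + nat b) - int (nat (- a) + nat (- b)) = a + b" for a b by auto
  ultimately show ?thesis by simp
qed

lemma recursive_int_diff [recursive_intros]:
  "recursive_int k f \<Longrightarrow> recursive_int k g \<Longrightarrow> recursive_int k (\<lambda>xs. f xs - g xs)"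
  using recursive_int_add[OF _ recursive_int_minus] by simp

lemma recursive_int_mult [recursive_intros]:
  assumes "recursive_int k f" "recursive_int k g"
  shows "recursive_int k (\<lambda>xs. f xs * g xs)"
proof -
  have "recursive_int k (\<lambda>xs. int (nat (f xs) * nat (g xs) + nat (- f xs) * nat (- g xs)) -
      int (nat (f xs) * nat (- g xs) + nat (- f xs) * nat (g xs)))"
    using assms unfolding recursive_int_def[of k f] recursive_int_def[of k g]
    by (intro recursive_int_diff_nat recursive_intros) auto
  moreover have "int (nat a * nat b + nat (- a) * nat (- b)) - int (nat a * nat (- b) + nat (- a) * nat b) = a * b"
    for a b
    by (cases "a \<ge> 0"; cases "b \<ge> 0") auto
  ultimately show ?thesis by simp
qed

lemma recursive_nat [recursive_intros]: "recursive_int k f \<Longrightarrow> recursive k (\<lambda>xs. nat (f xs))"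
  by (simp add: recursive_int_def)

lemma recursive_int_eq [recursive_intros]:
  assumes "recursive_int k f" "recursive_int k g"
  shows "recursive_pred_on k (\<lambda>xs. f xs = g xs)"
proof -
  have "recursive_pred_on k (\<lambda>xs. nat (f xs - g xs) = 0 \<and> nat (g xs - f xs) = 0)"
    by (intro recursive_intros assms)
  moreover have "nat (a - b) = 0 \<and> nat (b - a) = 0 \<longleftrightarrow> a = b" for a b by auto
  ultimately show ?thesis by simp
qed

lemma recursive_int_If [recursive_intros]:
  assumes "recursive_pred_on k P" "recursive_int k f" "recursive_int k g"
  shows "recursive_int k (\<lambda>xs. if P xs then f xs else g xs)"
proof -
  have "nat (if b then m else n) = (if b then nat m else nat n)" for b m n by simp
  then show ?thesis
    using assms unfolding recursive_int_def by (simp add: if_distrib[of uminus] recursive_If)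
qed

lemma recursive_int_encode [recursive_intros]:
  assumes "recursive_int k f"
  shows "recursive k (\<lambda>xs. int_encode (f xs))"
proof -
  have "recursive k (\<lambda>xs. if nat (- f xs) = 0 then 2 * nat (f xs) else 2 * nat (- f xs) - 1)"
    using assms by (intro recursive_intros)
  then show ?thesis
  proof (rule recursive_cong)
    show "(if nat (- f xs) = 0 then 2 * nat (f xs) else 2 * nat (- f xs) - 1) = int_encode (f xs)" for xs
      by (auto simp: int_encode_def sum_encode_def)
  qed
qed

lemma recursive_int_decode [recursive_intros]:
  assumes "recursive k f"
  shows "recursive_int k (\<lambda>xs. int_decode (f xs))"
proof -
  have "recursive_int k (\<lambda>xs. if even (f xs) then int (f xs div 2) else - int (Suc (f xs div 2)))"
    by (intro recursive_intros assms)
  moreover have "(if even n then int (n div 2) else - int (Suc (n div 2))) = int_decode n" for n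
    by (simp add: int_decode_def sum_decode_def)
  ultimately show ?thesis by simp
qed

text \<open>The positive and the negative parts are accumulated separately and subtracted at the
  end.\<close>

lemma recursive_int_sum_list:
  assumes l: "recursive k l"
    and g: "recursive_int (Suc (Suc k)) (\<lambda>xs. g (xs ! 0) (drop 2 xs))"
  shows "recursive_int k (\<lambda>xs. \<Sum>x\<leftarrow>list_decode (l xs). g x xs)"
proof -
  have "recursive k (\<lambda>xs. fold (\<lambda>x r. r + nat (h x xs)) (list_decode (l xs)) 0)"
    if "recursive_int (Suc (Suc k)) (\<lambda>xs. h (xs ! 0) (drop 2 xs))" for h
    using that by (intro recursive_fold[where g = "\<lambda>x r xs. r + nat (h x xs)"] recursive_intros l) auto
  from this[OF g] this[OF recursive_int_minus[OF g]]
  have "recursive_int k (\<lambda>xs. int (fold (\<lambda>x r. r + nat (g x xs)) (list_decode (l xs)) 0) -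
      int (fold (\<lambda>x r. r + nat (- g x xs)) (list_decode (l xs)) 0))"
    by (rule recursive_int_diff_nat)
  moreover have "int (fold (\<lambda>x r. r + nat (g x xs)) ys a) - int (fold (\<lambda>x r. r + nat (- g x xs)) ys b)
      = int a - int b + (\<Sum>x\<leftarrow>ys. g x xs)" for ys a b xs
    by (induction ys arbitrary: a b) auto
  ultimately show ?thesis by simp
qed


section \<open>Recognising normal words\<close>

text \<open>The state is \<open>0\<close> at the start, \<open>4\<close> after a failure, and the code of the last letter otherwise.\<close>

definition check_letter :: "nat \<Rightarrow> nat \<Rightarrow> nat" where
  "check_letter d r = (if r = 0 \<and> (d = 1 \<or> d = 2 \<or> d = 3) \<or> r = 1 \<and> (d = 1 \<or> d = 2) \<or>
     r = 2 \<and> (d = 2 \<or> d = 3) \<or> r = 3 \<and> (d = 3 \<or> d = 1) then d else 4)"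

lemma check_letter_symbol:
  assumes "s \<in> atoms"
  shows "check_letter (symbol_code s) 0 = symbol_code s"
    and "t \<in> atoms \<Longrightarrow> check_letter (symbol_code s) (symbol_code t) = (if s = nxt t then 4 else symbol_code s)"
proof -
  show "check_letter (symbol_code s) 0 = symbol_code s"
    using assms by (cases s; simp add: check_letter_def atoms_def)
  show "check_letter (symbol_code s) (symbol_code t) = (if s = nxt t then 4 else symbol_code s)"
    if "t \<in> atoms"
    using assms that by (cases s; cases t; simp add: check_letter_def atoms_def)
qed

lemma fold_check_letter:
  "normal_word w \<Longrightarrow>
    fold check_letter (map symbol_code w) 0 = (if w = [] then 0 else symbol_code (last w))"
proof (induction w rule: rev_induct)
  case (snoc s w)
  then have "w \<noteq> [] \<Longrightarrow> last w \<in> atoms" by (auto simp: normal_word_def)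
  with snoc show ?case by (auto simp: normal_word_snoc check_letter_symbol)
qed simp

text \<open>State 4 is absorbing, so a run that avoids it at the end has avoided it throughout; each
  state is then the last letter of a normal word that the next digit extends.\<close>

lemma fold_check_letter_imp:
  "fold check_letter ds 0 \<noteq> 4 \<Longrightarrow> \<exists>w. ds = map symbol_code w \<and> normal_word w"
proof (induction ds rule: rev_induct)
  case (snoc d ds)
  then have d: "check_letter d (fold check_letter ds 0) \<noteq> 4" by simp
  then have "fold check_letter ds 0 \<noteq> 4" by (auto simp: check_letter_def)
  then obtain w where w: "ds = map symbol_code w" "normal_word w" using snoc.IH by blast
  have "d \<in> {1, 2, 3}" using d by (auto simp: check_letter_def split: if_splits)
  then have "d \<in> symbol_code ` atoms" by (auto simp: atoms_def)
  then obtain s where s: "d = symbol_code s" "s \<in> atoms" by blast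
  have "w \<noteq> [] \<Longrightarrow> last w \<in> atoms" using w(2) by (auto simp: normal_word_def)
  then have "normal_word (w @ [s])"
    using d w s fold_check_letter[OF w(2)] by (auto simp: normal_word_snoc check_letter_symbol)
  then show ?case using w(1) s(1) by (intro exI[of _ "w @ [s]"]) simp
qed (intro exI[of _ "[]"], simp)


section \<open>The row vector of a normal word\<close>

definition fst_int :: "nat \<Rightarrow> int" where "fst_int r = int_decode (fst (prod_decode r))"
definition snd_int :: "nat \<Rightarrow> int" where "snd_int r = int_decode (snd (prod_decode r))"

text \<open>The state codes the two entries of the row \<open>(1, -1)\<close> times a Burau matrix
  at \<open>q = 3\<close>. The cases are right multiplication by the matrices of
  \<open>rho3_atoms\<close>, the factor -2 being \<open>1 - q\<close>; digit 4 is
  \<open>\<delta>\<close>.\<close>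

definition step_code :: "nat \<Rightarrow> nat \<Rightarrow> nat" where
  "step_code d r = prod_encode
     (int_encode (if d = 2 then fst_int r else if d = 1 then snd_int r - 3 * fst_int r else - 3 * snd_int r),
      int_encode (if d = 1 then snd_int r else if d = 3 then - fst_int r - 2 * snd_int r
        else 3 * fst_int r - 3 * snd_int r))"

abbreviation row_value :: "braid3 \<Rightarrow> simple_symbol \<Rightarrow> rat" where
  "row_value x s \<equiv> row_eval (burau_column (\<rho>\<^sub>3 x) s)"

text \<open>The sign appears because \<open>burau_column\<close> attaches the negated second column
  to \<open>A12\<close>.\<close>

definition represents :: "nat \<Rightarrow> braid3 \<Rightarrow> bool" where
  "represents r x \<longleftrightarrow> row_value x A23 = of_int (fst_int r) \<and> row_value x A12 = - of_int (snd_int r)"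

lemma represents_one: "represents (prod_encode (int_encode 1, int_encode (- 1))) 1"
  using eval3_diff[of 0 1]
  by (simp add: represents_def fst_int_def snd_int_def rho3_one row_eval_def column_def mat_def)

lemma represents_atom:
  assumes "represents r x" "s \<in> atoms"
  shows "represents (step_code (symbol_code s) r) (x * symbol_braid s)"
proof -
  have "s = A12 \<or> s = A23 \<or> s = A13" using assms(2) by (auto simp: atoms_def)
  then show ?thesis
    using assms(1) burau3.atom_fixed[OF assms(2), of x] burau3.atom_nxt[OF assms(2), of x]
      burau3.atom_nxt_nxt[OF assms(2), of x]
    unfolding represents_def step_code_def
    by (elim disjE; hypsubst)
      (simp_all add: fst_int_def[of "prod_encode _"] snd_int_def[of "prod_encode _"] row_eval_simps algebra_simps)
qed

lemma represents_delta: "represents r x \<Longrightarrow> represents (step_code 4 r) (x * \<delta>)"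
  using burau3.delta_shift[of A23 x] burau3.delta_shift[of A12 x]
  unfolding represents_def step_code_def
  by (simp add: fst_int_def[of "prod_encode _"] snd_int_def[of "prod_encode _"] row_eval_simps atoms_def
      algebra_simps)

definition garside_row_code :: "nat \<Rightarrow> nat list \<Rightarrow> nat" where
  "garside_row_code m ds =
     fold step_code ds ((step_code 4 ^^ m) (prod_encode (int_encode 1, int_encode (- 1))))"

lemma represents_garside:
  assumes "set w \<subseteq> atoms"
  shows "represents (garside_row_code m (map symbol_code w)) (garside (int m) w)"
proof -
  have "represents ((step_code 4 ^^ m) (prod_encode (int_encode 1, int_encode (- 1)))) (\<delta> ^ m)"
    by (induction m) (simp_all add: represents_one represents_delta power_Suc2 del: power_Suc)
  moreover have "represents (fold step_code (map symbol_code w) r) (x * word_braid w)"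
    if "represents r x" for r x
    using assms that
  proof (induction w arbitrary: r x)
    case (Cons s w)
    then show ?case
      using Cons.IH[OF _ represents_atom[OF Cons.prems(2)], of s] by (simp add: mult.assoc)
  qed simp
  ultimately show ?thesis by (simp add: garside_row_code_def garside_def)
qed

text \<open>The cube of \<open>\<delta>\<close> is central and acts as the scalar \<open>q\<^sup>3\<close>, which is \<open>27\<close> here; multiplying by it makes
  the power of \<open>\<delta>\<close> in a normal form non-negative.\<close>

lemma row_value_shift:
  assumes "set w \<subseteq> atoms" "s \<in> atoms"
  shows "row_value (garside (p + 3 * int j) w) s = 27 ^ j * row_value (garside p w) s"
proof (induction j)
  case (Suc j)
  define x where "x = garside (p + 3 * int j) w"
  have set: "set (map nxt v) \<subseteq> atoms" if "set v \<subseteq> atoms" for v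
    using that by auto
  \<comment> \<open>Each \<open>\<delta>\<close> relabels by \<open>nxt\<close> twice, and six
    relabellings are the identity.\<close>
  have "x * \<delta> * \<delta> * \<delta> = garside (p + 3 * int j + 1 + 1 + 1) (map nxt (map nxt (map nxt (map nxt (map nxt (map nxt w))))))"
    unfolding x_def using assms(1) set
    by (simp add: garside_delta del: map_map set_map)
  also have "map nxt (map nxt (map nxt (map nxt (map nxt (map nxt w))))) = w" by (simp add: o_def)
  also have "p + 3 * int j + 1 + 1 + 1 = p + 3 * int (Suc j)" by simp
  finally have "x * \<delta> * \<delta> * \<delta> = garside (p + 3 * int (Suc j)) w" .
  moreover have "row_value (x * \<delta> * \<delta> * \<delta>) s = 27 * row_value x s"
    using assms(2) by (simp add: burau3.delta_shift)
  ultimately show ?case using Suc by (simp add: x_def)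
qed simp


section \<open>Evaluating the input matrix\<close>

text \<open>Once \<open>3 * c\<close> lifts all exponents above zero, this is \<open>27 ^ c\<close>
  times the value at 3. The lift is a multiple of 3 to match multiplication by powers of the cube of
  \<open>\<delta>\<close>.\<close>

definition poly_value :: "nat \<Rightarrow> nat \<Rightarrow> int" where
  "poly_value c l = (\<Sum>t\<leftarrow>list_decode l. snd_int t * int (3 ^ nat (fst_int t + 3 * int c)))"

definition matrix_entry :: "nat \<Rightarrow> nat \<Rightarrow> nat" where
  "matrix_entry c i = fst (prod_decode ((tail_code ^^ i) c - 1))"

lemma matrix_entry_code:
  "matrix_entry (matrix_code \<Lambda>) 0 = laurent_code (\<Lambda> $ 1 $ 1)"
  "matrix_entry (matrix_code \<Lambda>) 1 = laurent_code (\<Lambda> $ 1 $ 2)"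
  "matrix_entry (matrix_code \<Lambda>) 2 = laurent_code (\<Lambda> $ 2 $ 1)"
  "matrix_entry (matrix_code \<Lambda>) 3 = laurent_code (\<Lambda> $ 2 $ 2)"
  by (simp_all add: matrix_entry_def matrix_code_def list_encode_drop del: list_encode.simps
      funpow.simps) (simp_all add: numeral_3_eq_3)

lemma poly_value_laurent_code:
  assumes "\<And>k. k \<in> Poly_Mapping.keys \<Lambda> \<Longrightarrow> - k \<le> 3 * int c"
  shows "of_int (poly_value c (laurent_code \<Lambda>)) = 27 ^ c * eval3 \<Lambda>"
proof -
  have "poly_value c (laurent_code \<Lambda>) =
      (\<Sum>k\<in>Poly_Mapping.keys \<Lambda>. Poly_Mapping.lookup \<Lambda> k * 3 ^ nat (k + 3 * int c))"
    by (simp add: poly_value_def laurent_code_def fst_int_def snd_int_def o_def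
        flip: sum_list_distinct_conv_sum_set[of "sorted_list_of_set (Poly_Mapping.keys \<Lambda>)", simplified])
  moreover have "(3 :: rat) ^ nat (k + 3 * int c) = 27 ^ c * 3 powi k" if "k \<in> Poly_Mapping.keys \<Lambda>" for k
  proof -
    have "(3 :: rat) ^ nat (k + 3 * int c) = 3 powi (k + 3 * int c)"
      using assms[OF that] by (simp add: power_int_def)
    also have "\<dots> = 3 powi k * 3 powi (3 * int c)" by (simp add: power_int_add)
    also have "(3 :: rat) powi (3 * int c) = 27 ^ c"
      using power_int_of_nat[of "3 :: rat" "3 * c"] by (simp add: power_mult)
    finally show ?thesis by simp
  qed
  ultimately show ?thesis
    by (simp add: eval3_def sum_distrib_left algebra_simps cong: sum.cong)
qed

lemma element_le_list_encode: "x \<in> set xs \<Longrightarrow> x \<le> list_encode xs"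
proof (induction xs)
  case (Cons y xs)
  then show ?case
    using le_prod_encode_1[of y "list_encode xs"] le_prod_encode_2[of "list_encode xs" y] by auto
qed simp

text \<open>No encoding falls below its components, so the matrix code bounds the negative exponents
  and can itself be the shift \<open>c\<close>.\<close>

lemma exponent_le_matrix_code:
  assumes "k \<in> Poly_Mapping.keys (\<Lambda> $ i $ j)"
  shows "- k \<le> int (matrix_code \<Lambda>)"
proof -
  have "- k \<le> int (int_encode k)" by (simp add: int_encode_def sum_encode_def)
  also have "int_encode k \<le> prod_encode (int_encode k, int_encode (Poly_Mapping.lookup (\<Lambda> $ i $ j) k))"
    by (rule le_prod_encode_1)
  also have "\<dots> \<le> laurent_code (\<Lambda> $ i $ j)"
    unfolding laurent_code_def using assms by (intro element_le_list_encode) auto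
  also have "\<dots> \<le> matrix_code \<Lambda>"
    unfolding matrix_code_def by (rule element_le_list_encode) (use exhaust_2[of i] exhaust_2[of j] in auto)
  finally show ?thesis by simp
qed


section \<open>Searching for the normal form\<close>

text \<open>A candidate \<open>n\<close> codes the shifted, hence natural, power of
  \<open>\<delta>\<close> and a list of digits. Entries 0 and 2 form the first column of the input
  matrix, entries 1 and 3 the second.\<close>

definition accepts :: "nat \<Rightarrow> nat \<Rightarrow> bool" where
  "accepts c n \<longleftrightarrow>
     fold check_letter (list_decode (snd (prod_decode n))) 0 \<noteq> 4 \<and>
     fst_int (garside_row_code (fst (prod_decode n)) (list_decode (snd (prod_decode n)))) =
       poly_value c (matrix_entry c 0) - poly_value c (matrix_entry c 2) \<and>
     snd_int (garside_row_code (fst (prod_decode n)) (list_decode (snd (prod_decode n)))) =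
       poly_value c (matrix_entry c 1) - poly_value c (matrix_entry c 3)"

lemma matrix_row_value:
  fixes x :: braid3
  defines "c \<equiv> matrix_code (\<rho>\<^sub>3 x)"
  shows "of_int (poly_value c (matrix_entry c 0) - poly_value c (matrix_entry c 2)) = 27 ^ c * row_value x A23"
    "of_int (poly_value c (matrix_entry c 1) - poly_value c (matrix_entry c 3)) = - (27 ^ c * row_value x A12)"
proof -
  have "of_int (poly_value c (laurent_code (\<rho>\<^sub>3 x $ i $ j))) = 27 ^ c * eval3 (\<rho>\<^sub>3 x $ i $ j)" for i j
    using exponent_le_matrix_code[of _ "\<rho>\<^sub>3 x" i j] by (intro poly_value_laurent_code) (force simp: c_def)
  then show "of_int (poly_value c (matrix_entry c 0) - poly_value c (matrix_entry c 2)) = 27 ^ c * row_value x A23"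
    "of_int (poly_value c (matrix_entry c 1) - poly_value c (matrix_entry c 3)) = - (27 ^ c * row_value x A12)"
    unfolding c_def matrix_entry_code
    by (simp_all add: row_eval_simps) (simp_all add: row_eval_def column_def algebra_simps)
qed

text \<open>Exactly one candidate is accepted, which gives both termination and correctness of the
  search.\<close>

lemma accepts_iff:
  assumes w: "normal_word w" and c: "c = matrix_code (\<rho>\<^sub>3 (garside p w))"
  shows "p + 3 * int c \<ge> 0"
    and "accepts c n \<longleftrightarrow> n = prod_encode (nat (p + 3 * int c), list_encode (map symbol_code w))"
proof -
  define x where "x = garside p w"
  \<comment> \<open>\<open>p\<close> is the lowest degree of the matrix, hence an exponent that
    occurs in it and is bounded by the code.\<close>
  have "Fin p \<in> {min_deg (\<rho>\<^sub>3 x $ i $ j) | i j. True}"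
    unfolding garside_min_deg[OF w, symmetric] mat_min_deg_def x_def
    by (rule Min_in[OF finite_matrix_entries]) auto
  then obtain i j where "min_deg (\<rho>\<^sub>3 x $ i $ j) = Fin p" by auto
  then have "p \<in> Poly_Mapping.keys (\<rho>\<^sub>3 x $ i $ j)"
    by (auto simp: min_deg_def split: if_splits intro!: Min_in)
  from exponent_le_matrix_code[OF this] show p: "p + 3 * int c \<ge> 0"
    by (simp add: c x_def)
  have row: "row_value (garside (p + 3 * int c) w) s = 27 ^ c * row_value x s" if "s \<in> atoms" for s
    using w that by (simp add: x_def row_value_shift normal_word_def)
  have atoms: "A12 \<in> atoms" "A23 \<in> atoms" by (auto simp: atoms_def)
  have accepts: "accepts c (prod_encode (m, list_encode (map symbol_code v))) \<longleftrightarrow>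
      int m = p + 3 * int c \<and> v = w" if v: "normal_word v" for m v
  proof -
    define r where "r = garside_row_code m (map symbol_code v)"
    have r: "represents r (garside (int m) v)"
      using v represents_garside by (simp add: r_def normal_word_def)
    have "fold check_letter (map symbol_code v) 0 \<noteq> 4"
      using v by (auto simp: fold_check_letter normal_word_def atoms_def dest!: last_in_set)
    then have "accepts c (prod_encode (m, list_encode (map symbol_code v))) \<longleftrightarrow>
        of_int (fst_int r) = 27 ^ c * row_value x A23 \<and> of_int (snd_int r) = - (27 ^ c * row_value x A12)"
      unfolding accepts_def x_def matrix_row_value[of "garside p w", folded c, symmetric] of_int_eq_iff
      by (simp add: r_def)
    \<comment> \<open>Two values settle all three, since the value at \<open>A13\<close> is minus
      the sum of the others.\<close>
    also have "\<dots> \<longleftrightarrow> (\<forall>s\<in>atoms. row_value (garside (int m) v) s = row_value (garside (p + 3 * int c) w) s)"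
      using r row atoms by (auto simp: represents_def atoms_def row_eval_simps right_diff_distrib)
    also have "\<dots> \<longleftrightarrow> int m = p + 3 * int c \<and> v = w"
      using normal_form_eqI[OF v w] by metis
    finally show ?thesis .
  qed
  show "accepts c n \<longleftrightarrow> n = prod_encode (nat (p + 3 * int c), list_encode (map symbol_code w))"
  proof
    assume n: "accepts c n"
    obtain m l where ml: "n = prod_encode (m, l)" by (metis prod_decode_inverse surj_pair)
    with n obtain v where v: "list_decode l = map symbol_code v" "normal_word v"
      using fold_check_letter_imp by (auto simp: accepts_def)
    then have l: "l = list_encode (map symbol_code v)" by (metis list_decode_inverse)
    show "n = prod_encode (nat (p + 3 * int c), list_encode (map symbol_code w))"
      using n accepts[OF v(2), of m] unfolding ml l by auto
  next
    assume "n = prod_encode (nat (p + 3 * int c), list_encode (map symbol_code w))"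
    then show "accepts c n" using accepts[OF w] p by simp
  qed
qed

section \<open>Computability of the search test\<close>

lemma recursive_fst_int [recursive_intros]: "recursive k f \<Longrightarrow> recursive_int k (\<lambda>xs. fst_int (f xs))"
  unfolding fst_int_def by (intro recursive_intros)

lemma recursive_snd_int [recursive_intros]: "recursive k f \<Longrightarrow> recursive_int k (\<lambda>xs. snd_int (f xs))"
  unfolding snd_int_def by (intro recursive_intros)

lemma recursive_step_code [recursive_intros]:
  "recursive k f \<Longrightarrow> recursive k g \<Longrightarrow> recursive k (\<lambda>xs. step_code (f xs) (g xs))"
  unfolding step_code_def by (intro recursive_intros)

lemma recursive_check_letter [recursive_intros]:
  "recursive k f \<Longrightarrow> recursive k g \<Longrightarrow> recursive k (\<lambda>xs. check_letter (f xs) (g xs))"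
  unfolding check_letter_def by (intro recursive_intros)

lemma recursive_garside_row_code [recursive_intros]:
  assumes "recursive k f" "recursive k g"
  shows "recursive k (\<lambda>xs. garside_row_code (f xs) (list_decode (g xs)))"
  unfolding garside_row_code_def
proof (rule recursive_fold[where g = "\<lambda>d r _. step_code d r"])
  show "recursive k (\<lambda>xs. (step_code 4 ^^ f xs) (prod_encode (int_encode 1, int_encode (- 1))))"
    by (rule recursive_iterate[where g = "\<lambda>r _. step_code 4 r"]) (intro recursive_intros assms; simp)+
qed (intro recursive_intros assms; simp)+

lemma recursive_poly_value [recursive_intros]:
  assumes "recursive k f" "recursive k g"
  shows "recursive_int k (\<lambda>xs. poly_value (f xs) (g xs))"
  unfolding poly_value_def
proof (rule recursive_int_sum_list[where g = "\<lambda>t xs. snd_int t * int (3 ^ nat (fst_int t + 3 * int (f xs)))"])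
  have "recursive (Suc (Suc k)) (\<lambda>xs. f (drop 2 xs))"
    using recursive_weaken[OF recursive_weaken[OF assms(1)]] by (simp add: drop_Suc numeral_2_eq_2)
  then show "recursive_int (Suc (Suc k)) (\<lambda>xs. snd_int (xs ! 0) *
      int (3 ^ nat (fst_int (xs ! 0) + 3 * int (f (drop 2 xs)))))"
    by (intro recursive_intros) simp_all
qed (rule assms)

lemma recursive_matrix_entry [recursive_intros]:
  "recursive k f \<Longrightarrow> recursive k (\<lambda>xs. matrix_entry (f xs) i)"
  unfolding matrix_entry_def by (intro recursive_intros recursive_drop_code)

lemma recursive_accepts: "recursive_pred_on 2 (\<lambda>xs. accepts (xs ! 1) (xs ! 0))"
proof -
  have "recursive 2 (\<lambda>xs. fold check_letter (list_decode (snd (prod_decode (xs ! 0)))) 0)"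
    by (rule recursive_fold[where g = "\<lambda>d r _. check_letter d r"]) (intro recursive_intros; simp)+
  then show ?thesis unfolding accepts_def by (intro recursive_intros) simp_all
qed

lemma ex_normal_form_algorithm: "\<exists>e. \<forall>x. outputs_dual_nf e (\<rho>\<^sub>3 x) (dual_nf x)"
proof -
  \<comment> \<open>\<open>Mu\<close> looks for a zero, hence the negated test; it puts the
    candidate in front of the matrix code.\<close>
  obtain e where e: "\<And>xs. length xs = 2 \<Longrightarrow> computes e xs (of_bool (\<not> accepts (xs ! 1) (xs ! 0)))"
    using recursive_not[OF recursive_accepts] unfolding recursive_def by blast
  \<comment> \<open>Undoes the shift of the power by \<open>3 * c\<close>; the list part is already
    the code of the word.\<close>
  define out where
    "out xs = prod_encode (int_encode (int (fst (prod_decode (xs ! 0))) - 3 * int (xs ! 1)),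
      snd (prod_decode (xs ! 0)))" for xs
  have "recursive 2 out" unfolding out_def by (intro recursive_intros) simp_all
  then obtain d where d: "\<And>xs. length xs = 2 \<Longrightarrow> computes d xs (out xs)"
    unfolding recursive_def by blast
  have "outputs_dual_nf (Comp d [Mu e, Proj 0]) (\<rho>\<^sub>3 x) (dual_nf x)" for x
  proof -
    obtain p w where w: "normal_word w" and x: "x = garside p w" using ex_garside by blast
    define c where "c = matrix_code (\<rho>\<^sub>3 x)"
    define n where "n = prod_encode (nat (p + 3 * int c), list_encode (map symbol_code w))"
    have accepts: "accepts c m \<longleftrightarrow> m = n" for m
      using accepts_iff(2)[OF w] by (simp add: n_def c_def x)
    have "computes e [n, c] 0" using e[of "[n, c]"] accepts by simp
    moreover have "computes e [m, c] (Suc 0)" if "m < n" for m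
      using e[of "[m, c]"] accepts that by simp
    ultimately have "computes (Mu e) [c] n" by (blast intro: computes.mu)
    moreover have "computes (Proj 0) [c] c" using computes.proj[of 0 "[c]"] by simp
    ultimately have "computes (Comp d [Mu e, Proj 0]) [c] (out [n, c])"
      by (intro computes.comp[where ys = "[n, c]"] d) (auto simp: less_Suc_eq)
    moreover have "out [n, c] = nf_code p w"
      using accepts_iff(1)[OF w, of c p] by (simp add: out_def n_def nf_code_def c_def x)
    ultimately show ?thesis
      unfolding outputs_dual_nf_def c_def using dual_nf_garside[OF w] x by metis
  qed
  then show ?thesis by blast
qed

theorem corollary6p11:
  shows "(\<forall>x :: braid3. Fin (sup_d x) = mat_max_deg (\<rho>\<^sub>3 x)) \<and>
         (\<forall>x :: braid3. Fin (inf_d x) = mat_min_deg (\<rho>\<^sub>3 x)) \<and>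
         (\<exists>e :: recfn. \<forall>x :: braid3. outputs_dual_nf e (\<rho>\<^sub>3 x) (dual_nf x))"
proof (intro conjI allI)
  fix x :: braid3
  obtain p w where w: "normal_word w" and x: "x = garside p w" using ex_garside by blast
  show "Fin (sup_d x) = mat_max_deg (\<rho>\<^sub>3 x)"
    by (simp add: x sup_d_def dual_nf_garside[OF w] garside_max_deg[OF w])
  show "Fin (inf_d x) = mat_min_deg (\<rho>\<^sub>3 x)"
    by (simp add: x inf_d_def dual_nf_garside[OF w] garside_min_deg[OF w])
qed (rule ex_normal_form_algorithm)

end
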